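(* Let $X$ be a complex separable infinite-dimensional Banach space and let $T\in\mathcal{L}(X)$. Suppose that $\Omega(T)$ is non-empty. If there exist a strictly increasing sequence of positive integers $(\theta_n)_n$ and an infinite-dimensional closed subspace $E\subset X$ such that $$\sup_n \|T^{\theta_n}|_E\|<\infty,$$ then for any SOT-separable subset $F\subset\Omega(T)$, the set $$\bigcap_{h\in F}\mathrm{R}(T,h)$$ is spaceable.
   Context: $\mathcal{L}(X)$ is the space of continuous linear operators on $X$; SOT is the strong operator topology (pointwise convergence) on $\mathcal{L}(X)$. A subset of $\mathcal{L}(X)$ is SOT-separable if it contains a countable subset that is dense in it for SOT. For $T\in\mathcal{L}(X)$, $\Omega(T)$ is the set of all $h\in\mathcal{L}(X)$ for which there is a strictly increasing sequence of positive integers $(\omega_n)_n$ such that $\{x\in X: T^{\omega_n}x\to h(x) \text{ as } n\to\infty\}$ is dense in $X$. For $h\in\mathcal{L}(X)$, $\mathrm{R}(T,h)$ is the set of $x\in X$ for which there is a strictly increasing sequence of positive integers $(\omega_n)_n$ with $\lim_{n}T^{\omega_n}x=h(x)$. A subset $A\subset X$ is spaceable if $A\cup\{0\}$ contains an infinite-dimensional closed linear subspace of $X$. *)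

theory Defs
  imports "HOL-Analysis.Analysis"
begin

text \<open>The distribution only has real Banach spaces. A complex Banach space is a real one with a
  complex scalar multiplication that extends the real one and makes the norm homogeneous.\<close>

class complex_banach = banach +
  fixes scaleC :: "complex \<Rightarrow> 'a \<Rightarrow> 'a"  (infixr \<open>*\<^sub>C\<close> 75)
  assumes scaleC_add_right: "a *\<^sub>C (x + y) = a *\<^sub>C x + a *\<^sub>C y"
    and scaleC_add_left: "(a + b) *\<^sub>C x = a *\<^sub>C x + b *\<^sub>C x"
    and scaleC_scaleC: "a *\<^sub>C b *\<^sub>C x = (a * b) *\<^sub>C x"
    and scaleC_one: "1 *\<^sub>C x = x"
    and scaleR_scaleC: "r *\<^sub>R x = complex_of_real r *\<^sub>C x"
    and norm_scaleC: "norm (a *\<^sub>C x) = cmod a * norm x"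

global_interpretation complex_vector: vector_space "scaleC :: complex \<Rightarrow> 'a \<Rightarrow> 'a :: complex_banach"
  by standard (fact scaleC_add_right scaleC_add_left scaleC_scaleC scaleC_one)+

definition infinite_dimensional :: "'a::complex_banach set \<Rightarrow> bool" where
  "infinite_dimensional E \<longleftrightarrow> \<not> (\<exists>B. finite B \<and> complex_vector.span B = E)"

definition inf_dim_closed_subspace :: "'a::complex_banach set \<Rightarrow> bool" where
  "inf_dim_closed_subspace E \<longleftrightarrow>
     complex_vector.subspace E \<and> closed E \<and> infinite_dimensional E"

definition spaceable :: "'a::complex_banach set \<Rightarrow> bool" where
  "spaceable A \<longleftrightarrow> (\<exists>E. inf_dim_closed_subspace E \<and> E \<subseteq> A \<union> {0})"

text \<open>The type of bounded linear functions only records real linearity, so the complex operators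
  form a subset of it; their strong operator topology is the one inherited from
  \<^const>\<open>strong_operator_topology\<close>.\<close>

definition complex_operators :: "('a::complex_banach \<Rightarrow>\<^sub>L 'a) set" where
  "complex_operators = {T. \<forall>c x. blinfun_apply T (c *\<^sub>C x) = c *\<^sub>C blinfun_apply T x}"

definition SOT_separable :: "('a::complex_banach \<Rightarrow>\<^sub>L 'a) set \<Rightarrow> bool" where
  "SOT_separable F \<longleftrightarrow> separable_space (subtopology strong_operator_topology F)"

definition pos_strict_seq :: "(nat \<Rightarrow> nat) \<Rightarrow> bool" where
  "pos_strict_seq \<omega> \<longleftrightarrow> strict_mono \<omega> \<and> (\<forall>n. 0 < \<omega> n)"

definition Omega_limits :: "('a::complex_banach \<Rightarrow>\<^sub>L 'a) \<Rightarrow> ('a \<Rightarrow>\<^sub>L 'a) set" where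
  "Omega_limits T = {h \<in> complex_operators. \<exists>\<omega>. pos_strict_seq \<omega> \<and>
     closure {x. (\<lambda>n. (blinfun_apply T ^^ \<omega> n) x) \<longlonglongrightarrow> blinfun_apply h x} = UNIV}"

definition R_set :: "('a::complex_banach \<Rightarrow>\<^sub>L 'a) \<Rightarrow> ('a \<Rightarrow>\<^sub>L 'a) \<Rightarrow> 'a set" where
  "R_set T h = {x. \<exists>\<omega>. pos_strict_seq \<omega> \<and>
     (\<lambda>n. (blinfun_apply T ^^ \<omega> n) x) \<longlonglongrightarrow> blinfun_apply h x}"

text \<open>Operator norm of the restriction of \<open>f\<close> to a subspace \<open>E\<close>, in the form of
  \<^const>\<open>onorm\<close>. The supremum is genuine when \<open>f\<close> is bounded linear and \<open>E\<close> is nonempty;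
  \<open>x = 0\<close> contributes \<open>0 / 0 = 0\<close>.\<close>

definition onorm_on :: "'a::real_normed_vector set \<Rightarrow> ('a \<Rightarrow> 'a) \<Rightarrow> real" where
  "onorm_on E f = (SUP x\<in>E. norm (f x) / norm x)"

end

theory Submission
  imports Defs
begin

text \<open>
Write \<open>S\<^sub>n\<close> for the partial sums \<open>\<Sum>i<n. a\<^sub>i e\<^sub>i\<close>. The subspace that is sought is the closed span of a
sequence \<open>f\<^sub>n\<close> that is a small perturbation of a normalised basic sequence \<open>e\<^sub>n\<close>.

The boundedness of \<open>T\<^bsup>\<theta> n\<^esup>\<close> on \<open>E\<close> is used through a dichotomy on the unit circle. Either some \<open>\<mu>\<close> of
modulus one is an approximate eigenvalue of \<open>T\<close> on every subspace of finite codimension; then there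
are unit vectors in each such subspace on which finitely many powers \<open>T\<^sup>k\<close> are as close to \<open>\<mu>\<^sup>k\<close> as
desired. Or, by compactness of the circle, there are \<open>c > 0\<close> and a subspace \<open>L\<close> of finite codimension
with \<open>c \<parallel>y\<parallel> \<le> \<parallel>T y - \<mu> y\<parallel>\<close> for all \<open>y\<close> in \<open>L\<close> and all \<open>\<mu>\<close> of modulus one. In the second case let \<open>x\<close> be a
vector of \<open>E\<close> with \<open>T\<^sup>i x\<close> in \<open>L\<close> for \<open>i < N\<close>, where \<open>N\<close> is some \<open>\<theta> n\<close>. If \<open>z\<close> is an \<open>N\<close>-th root of unity, then
\<open>u = \<Sum>i<N. z\<^sup>i T\<^sup>i x\<close> satisfies \<open>z T u - u = T\<^sup>N x - x\<close>, which bounds \<open>u\<close>, and averaging over the roots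
of unity recovers \<open>T\<^sup>k x\<close> for \<open>k < N\<close>. So all powers up to a given order are bounded by one constant on a
subspace of \<open>E\<close> of finite relative codimension (\<open>orbit_bound_by_averaging\<close>). Both cases are summarised
in \<open>exists_bounded_directions\<close>.

The second ingredient is a dense sequence \<open>d\<close> in the space such that for every \<open>h\<close> in a given countable
subset of \<open>\<Omega>(T)\<close> any finitely many terms of \<open>d\<close> are simultaneously carried close to their images under \<open>h\<close>
by arbitrarily large powers of \<open>T\<close>. It exists by Baire's theorem in the product of countably many copies of
the space (\<open>common_dense_sequence\<close>).

Now choose in turn \<open>e\<^sub>n\<close>, a nearby \<open>f\<^sub>n\<close> among the terms of \<open>d\<close>, and a time \<open>\<kappa> n\<close> at which \<open>T\<^bsup>\<kappa> n\<^esup>\<close> is close to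
\<open>H n\<close> on \<open>f\<^sub>0, \<dots>, f\<^sub>n\<close>; here \<open>H\<close> lists a countable dense set of operators of \<open>F\<close>, each of them
infinitely often. The vector \<open>e\<^sub>n\<close> lies in the kernel of functionals that almost norm the span of
its predecessors, which makes the sequence basic, and in directions in which the powers of order
\<open>\<kappa> 0, \<dots>, \<kappa> (n - 1)\<close> are bounded up to a small error (\<open>interlaced_sequences\<close>). For \<open>x = \<Sum>i<N. a\<^sub>i f\<^sub>i\<close> the head
\<open>i \<le> n\<close> of \<open>T\<^bsup>\<kappa> n\<^esup> x\<close> is close to \<open>H n\<close> of a partial sum of \<open>x\<close>, and the tail is bounded by the
choice of the \<open>e\<^sub>i\<close> with \<open>i > n\<close>. Hence the operators \<open>T\<^bsup>\<kappa> n\<^esup>\<close> with \<open>H n = h\<close> are uniformly bounded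
on the span of the \<open>f\<^sub>i\<close>, and they converge to \<open>h\<close> there; both facts together give convergence on the closed
span. Density for the strong operator topology extends recurrence from the countable set to \<open>F\<close>.
\<close>

section \<open>Norming functionals\<close>

text \<open>
Sublinear functionals dominated by the norm. A minimal one is linear, which yields the Hahn-Banach
theorem in the form needed here without extending functionals from subspaces.
\<close>

definition norm_sublinear :: "('a::real_normed_vector \<Rightarrow> real) set" where
  "norm_sublinear = {p. (\<forall>x y. p (x + y) \<le> p x + p y) \<and> (\<forall>t x. 0 \<le> t \<longrightarrow> p (t *\<^sub>R x) = t * p x)
     \<and> (\<forall>x. p x \<le> norm x)}"

lemma norm_sublinearD:
  assumes "p \<in> norm_sublinear"
  shows "p (x + y) \<le> p x + p y" "0 \<le> t \<Longrightarrow> p (t *\<^sub>R x) = t * p x" "p x \<le> norm x"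
    "p 0 = 0" "- p (- x) \<le> p x" "- norm x \<le> p x"
proof -
  show 1: "p (x + y) \<le> p x + p y" "0 \<le> t \<Longrightarrow> p (t *\<^sub>R x) = t * p x" "p x \<le> norm x" for x y t
    using assms by (auto simp: norm_sublinear_def)
  show 0: "p 0 = 0" using 1(2)[of 0 0] by simp
  show 2: "- p (- x) \<le> p x" using 1(1)[of x "- x"] 0 by simp
  show "- norm x \<le> p x" using 2 1(3)[of "- x"] by simp
qed

text \<open>
If \<open>p\<close> is minimal, this forces \<open>p (- y) \<le> - p y\<close> for all \<open>y\<close>. The witness is
\<open>q x = (INF t\<in>{0..}. p (x + t y) - t p y)\<close>.
\<close>

lemma norm_sublinear_improve:
  fixes y :: "'a::real_normed_vector"
  assumes p: "p \<in> norm_sublinear"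
  obtains q where "q \<in> norm_sublinear" "q \<le> p" "q (- y) \<le> - p y"
proof -
  note D = norm_sublinearD[OF p]
  define q where "q x = (INF t\<in>{0..}. p (x + t *\<^sub>R y) - t * p y)" for x
  have lower: "- p (- x) \<le> p (x + t *\<^sub>R y) - t * p y" if "0 \<le> t" for x t
    using D(1)[of "x + t *\<^sub>R y" "- x"] D(2)[OF that, of y] by simp
  have bdd: "bdd_below ((\<lambda>t. p (x + t *\<^sub>R y) - t * p y) ` {0..})" for x
    using lower by (intro bdd_belowI2[of _ "- p (- x)"]) auto
  have q_le: "q x \<le> p (x + t *\<^sub>R y) - t * p y" if "0 \<le> t" for x t
    unfolding q_def using that by (intro cINF_lower[OF bdd]) auto
  have q_ge: "c \<le> q x" if "\<And>t. 0 \<le> t \<Longrightarrow> c \<le> p (x + t *\<^sub>R y) - t * p y" for c x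
    unfolding q_def using that by (intro cINF_greatest) auto
  have qp: "q x \<le> p x" for x using q_le[of 0 x] by simp
  have sub: "q (x + x') \<le> q x + q x'" for x x'
  proof -
    have "q (x + x') - (p (x' + t' *\<^sub>R y) - t' * p y) \<le> q x" if "0 \<le> t'" for t'
    proof (rule q_ge)
      fix t :: real assume t: "0 \<le> t"
      have "q (x + x') \<le> p ((x + x') + (t + t') *\<^sub>R y) - (t + t') * p y"
        using q_le[of "t + t'" "x + x'"] t that by simp
      also have "p ((x + x') + (t + t') *\<^sub>R y) \<le> p (x + t *\<^sub>R y) + p (x' + t' *\<^sub>R y)"
        using D(1)[of "x + t *\<^sub>R y" "x' + t' *\<^sub>R y"] by (simp add: algebra_simps)
      finally show "q (x + x') - (p (x' + t' *\<^sub>R y) - t' * p y) \<le> p (x + t *\<^sub>R y) - t * p y"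
        by (simp add: algebra_simps)
    qed
    then have "q (x + x') - q x \<le> q x'" by (intro q_ge) (auto simp: algebra_simps)
    then show ?thesis by simp
  qed
  have hom_le: "q (s *\<^sub>R x) \<le> s * q x" if "0 < s" for s x
  proof -
    have "q (s *\<^sub>R x) / s \<le> q x"
    proof (rule q_ge)
      fix t :: real assume t: "0 \<le> t"
      have "q (s *\<^sub>R x) \<le> p (s *\<^sub>R (x + t *\<^sub>R y)) - s * t * p y"
        using q_le[of "s * t" "s *\<^sub>R x"] t that by (simp add: algebra_simps)
      also have "\<dots> = s * (p (x + t *\<^sub>R y) - t * p y)"
        using D(2)[of s "x + t *\<^sub>R y"] that by (simp add: right_diff_distrib)
      finally show "q (s *\<^sub>R x) / s \<le> p (x + t *\<^sub>R y) - t * p y"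
        using that by (simp add: field_simps)
    qed
    then show ?thesis using that by (simp add: field_simps)
  qed
  have q0: "q 0 = 0"
    using qp[of 0] q_ge[of 0 0] lower[of _ 0] D(4) by (fastforce intro: antisym)
  have hom: "q (s *\<^sub>R x) = s * q x" if "0 \<le> s" for s x
  proof (cases "s = 0")
    case False
    then have "0 < s" using that by simp
    from hom_le[OF this, of x] hom_le[of "1/s" "s *\<^sub>R x"] this
    show ?thesis by (simp add: field_simps)
  qed (simp add: q0)
  show thesis
  proof
    show "q \<in> norm_sublinear"
      unfolding norm_sublinear_def using sub hom order_trans[OF qp D(3)] by auto
    show "q \<le> p" using qp by (simp add: le_fun_def)
    show "q (- y) \<le> - p y" using q_le[of 1 "- y"] D(4) by simp
  qed
qed

text \<open>Zorn's lemma: the pointwise infimum of a chain is again sublinear.\<close>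

lemma norm_sublinear_minimal:
  assumes p0: "(p0 :: 'a::real_normed_vector \<Rightarrow> real) \<in> norm_sublinear"
  obtains p where "p \<in> norm_sublinear" "p \<le> p0" "\<And>q. q \<in> norm_sublinear \<Longrightarrow> q \<le> p \<Longrightarrow> q = p"
proof -
  define A where "A = {p \<in> norm_sublinear. p \<le> p0}"
  let ?r = "relation_of (\<ge>) A"
  have po: "partial_order_on A ?r"
    by (rule partial_order_on_relation_ofI) auto
  have "\<exists>m\<in>A. \<forall>a\<in>A. m \<ge> a \<longrightarrow> a = m"
  proof (rule predicate_Zorn[OF po])
    fix C assume C: "C \<in> Chains ?r"
    then have CA: "C \<subseteq> A" and ch: "\<And>p q. p \<in> C \<Longrightarrow> q \<in> C \<Longrightarrow> q \<le> p \<or> p \<le> q"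
      by (auto simp: Chains_def relation_of_def)
    show "\<exists>u\<in>A. \<forall>a\<in>C. u \<le> a"
    proof (cases "C = {}")
      case True
      then show ?thesis using p0 by (auto simp: A_def)
    next
      case False
      have D: "p \<in> norm_sublinear" "p \<le> p0" if "p \<in> C" for p using that CA by (auto simp: A_def)
      define u where "u x = (INF p\<in>C. p x)" for x
      have bdd: "bdd_below ((\<lambda>p. p x) ` C)" for x
        using norm_sublinearD(6)[OF D(1)] by (intro bdd_belowI2[of _ "- norm x"]) auto
      have u_le: "u x \<le> p x" if "p \<in> C" for p x
        unfolding u_def by (rule cINF_lower[OF bdd that])
      have u_ge: "c \<le> u x" if "\<And>p. p \<in> C \<Longrightarrow> c \<le> p x" for c x
        unfolding u_def using that by (intro cINF_greatest[OF False]) auto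
      have sub: "u (x + y) \<le> u x + u y" for x y
      proof -
        have "u (x + y) - q y \<le> u x" if q: "q \<in> C" for q
        proof (rule u_ge)
          fix p assume p: "p \<in> C"
          then obtain r where r: "r \<in> C" "r \<le> p" "r \<le> q" using ch[OF p q] q by auto
          then have "u (x + y) \<le> r x + r y"
            using u_le[OF r(1), of "x + y"] norm_sublinearD(1)[OF D(1)[OF r(1)], of x y] by simp
          also have "\<dots> \<le> p x + q y" using r(2,3) by (intro add_mono) (auto simp: le_fun_def)
          finally show "u (x + y) - q y \<le> p x" by simp
        qed
        then have "u (x + y) - u x \<le> u y" by (intro u_ge) (auto simp: algebra_simps)
        then show ?thesis by simp
      qed
      have hom_le: "u (s *\<^sub>R x) \<le> s * u x" if "0 < s" for s x
      proof -
        have "u (s *\<^sub>R x) / s \<le> u x"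
          using u_le[of _ "s *\<^sub>R x"] norm_sublinearD(2)[OF D(1)] that
          by (intro u_ge) (force simp: field_simps)
        then show ?thesis using that by (simp add: field_simps)
      qed
      have u0: "u 0 = 0"
      proof (rule antisym)
        obtain p where p: "p \<in> C" using False by auto
        then show "u 0 \<le> 0" using u_le[of p 0] norm_sublinearD(4)[OF D(1)[of p]] by simp
        show "0 \<le> u 0" by (rule u_ge) (simp add: norm_sublinearD(4)[OF D(1)])
      qed
      have hom: "u (s *\<^sub>R x) = s * u x" if "0 \<le> s" for s x
      proof (cases "s = 0")
        case False
        then have "0 < s" using that by simp
        from hom_le[OF this, of x] hom_le[of "1/s" "s *\<^sub>R x"] this
        show ?thesis by (simp add: field_simps)
      qed (simp add: u0)
      obtain p1 where p1: "p1 \<in> C" using False by auto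
      have "u \<in> norm_sublinear"
        unfolding norm_sublinear_def
        using sub hom order_trans[OF u_le[OF p1] norm_sublinearD(3)[OF D(1)[OF p1]]] by auto
      moreover have "u \<le> p0"
        using u_le[OF p1] D(2)[OF p1] by (auto simp: le_fun_def intro: order_trans)
      ultimately show ?thesis using u_le by (auto simp: A_def le_fun_def intro!: bexI[of _ u])
    qed
  qed
  then obtain m where "m \<in> A" "\<forall>a\<in>A. a \<le> m \<longrightarrow> a = m" by auto
  then show thesis by (intro that[of m]) (auto simp: A_def intro: order_trans)
qed

lemma norming_real_functional:
  fixes z :: "'a::real_normed_vector"
  obtains u :: "'a \<Rightarrow> real" where "linear u" "\<And>x. \<bar>u x\<bar> \<le> norm x" "u z = norm z"
proof -
  have "norm \<in> (norm_sublinear :: ('a \<Rightarrow> real) set)"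
    by (auto simp: norm_sublinear_def norm_triangle_ineq)
  then obtain p0 where p0: "p0 \<in> norm_sublinear" "p0 (- z) \<le> - norm z"
    using norm_sublinear_improve[of norm z] by blast
  obtain p where p: "p \<in> norm_sublinear" "p \<le> p0"
    and min: "\<And>q. q \<in> norm_sublinear \<Longrightarrow> q \<le> p \<Longrightarrow> q = p"
    using norm_sublinear_minimal[OF p0(1)] by blast
  note D = norm_sublinearD[OF p(1)]
  have "p (- y) \<le> - p y" for y
    using norm_sublinear_improve[OF p(1), of y] min by metis
  then have neg: "p (- y) = - p y" for y using D(5)[of y] by (simp add: order_antisym minus_le_iff)
  have add: "p (x + y) = p x + p y" for x y
    using D(1)[of x y] D(1)[of "- x" "- y"] neg[of x] neg[of y] neg[of "x + y"] by simp
  have scale: "p (t *\<^sub>R x) = t * p x" for t x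
    using D(2)[of t x] D(2)[of "- t" x] neg[of "t *\<^sub>R x"] by (cases "0 \<le> t") auto
  show thesis
  proof
    show "linear p" by (rule linearI) (simp_all add: add scale)
    show "\<bar>p x\<bar> \<le> norm x" for x using D(3)[of x] D(6)[of x] by simp
    have "- norm z \<ge> p (- z)" using p(2) p0(2) by (auto simp: le_fun_def intro: order_trans)
    then show "p z = norm z" using neg[of z] D(3)[of z] by simp
  qed
qed

text \<open>
Complex-linear functionals, continuous or not. Only the norming ones need to be bounded.
\<close>

definition clinear_functional :: "('a::complex_banach \<Rightarrow> complex) \<Rightarrow> bool" where
  "clinear_functional \<phi> \<longleftrightarrow> (\<forall>x y. \<phi> (x + y) = \<phi> x + \<phi> y) \<and> (\<forall>c x. \<phi> (c *\<^sub>C x) = c * \<phi> x)"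

lemma norming_functional:
  fixes z :: "'a::complex_banach"
  obtains \<phi> where "clinear_functional \<phi>" "\<And>x. cmod (\<phi> x) \<le> norm x" "\<phi> z = norm z"
proof -
  obtain u :: "'a \<Rightarrow> real" where u: "linear u" and le: "\<And>x. \<bar>u x\<bar> \<le> norm x" and z: "u z = norm z"
    using norming_real_functional by blast
  note ua = linear_add[OF u] and us = linear_scale[OF u]
  \<comment> \<open>the complex-linear functional with real part \<open>u\<close>\<close>
  define \<phi> where "\<phi> x = Complex (u x) (- u (\<i> *\<^sub>C x))" for x
  have dec: "c *\<^sub>C x = Re c *\<^sub>R x + Im c *\<^sub>R (\<i> *\<^sub>C x)" for c and x :: 'a
    unfolding scaleR_scaleC scaleC_scaleC scaleC_add_left[symmetric]
    by (simp add: complex_eq mult.commute)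
  have ii: "\<i> *\<^sub>C \<i> *\<^sub>C x = - x" for x :: 'a
    using dec[of "-1" x] by (simp add: scaleC_scaleC)
  have comm: "\<i> *\<^sub>C (r *\<^sub>R x) = r *\<^sub>R (\<i> *\<^sub>C x)" for r and x :: 'a
    by (simp add: scaleR_scaleC scaleC_scaleC mult.commute)
  have lin: "\<phi> (x + y) = \<phi> x + \<phi> y" for x y
    by (simp add: \<phi>_def ua scaleC_add_right complex_eq_iff)
  have hom: "\<phi> (c *\<^sub>C x) = c * \<phi> x" for c x
  proof -
    have 1: "u (c *\<^sub>C x) = Re c * u x + Im c * u (\<i> *\<^sub>C x)"
      by (subst dec) (simp add: ua us)
    have "\<i> *\<^sub>C c *\<^sub>C x = Re c *\<^sub>R (\<i> *\<^sub>C x) - Im c *\<^sub>R x"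
      by (subst (2) dec) (simp add: scaleC_add_right comm ii)
    then have 2: "u (\<i> *\<^sub>C c *\<^sub>C x) = Re c * u (\<i> *\<^sub>C x) - Im c * u x"
      by (simp add: linear_diff[OF u] us scaleC_scaleC)
    show ?thesis by (simp add: \<phi>_def complex_eq_iff 1 2[unfolded scaleC_scaleC])
  qed
  have bound: "cmod (\<phi> x) \<le> norm x" for x
  proof (cases "\<phi> x = 0")
    case False
    \<comment> \<open>rotate \<open>x\<close> so that the value of \<open>\<phi>\<close> becomes real, hence a value of \<open>u\<close>\<close>
    define c where "c = cnj (sgn (\<phi> x))"
    have "c * \<phi> x = cmod (\<phi> x)"
      using False complex_norm_square[of "\<phi> x"]
      by (simp add: c_def sgn_div_norm scaleR_conv_of_real power2_eq_square field_simps)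
    then have "cmod (\<phi> x) = u (c *\<^sub>C x)"
      using hom[of c x] by (simp add: \<phi>_def complex_eq_iff)
    also have "\<dots> \<le> norm (c *\<^sub>C x)" using le[of "c *\<^sub>C x"] by simp
    also have "\<dots> = norm x" using False by (simp add: norm_scaleC c_def norm_sgn)
    finally show ?thesis .
  qed simp
  have "cmod (\<phi> z) \<le> Re (\<phi> z)" using bound[of z] z by (simp add: \<phi>_def)
  then have "(cmod (\<phi> z))\<^sup>2 \<le> (Re (\<phi> z))\<^sup>2" by (rule power_mono) simp
  then have "Im (\<phi> z) = 0" by (simp add: cmod_power2)
  then have "\<phi> z = norm z" using z by (simp add: \<phi>_def complex_eq_iff)
  with lin hom bound show thesis by (intro that[of \<phi>]) (auto simp: clinear_functional_def)
qed

section \<open>Kernels of finitely many functionals\<close>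

text \<open>For finite sets \<open>\<Phi>\<close> of complex-linear functionals these are the subspaces of finite codimension.\<close>

definition common_kernel :: "('a::complex_banach \<Rightarrow> complex) set \<Rightarrow> 'a set" where
  "common_kernel \<Phi> = {x. \<forall>\<phi>\<in>\<Phi>. \<phi> x = 0}"

lemma clinear_functional_0: "clinear_functional \<phi> \<Longrightarrow> \<phi> 0 = 0"
  unfolding clinear_functional_def by (metis add_cancel_right_right)

lemma subspace_common_kernel:
  assumes \<Phi>: "\<And>\<phi>. \<phi> \<in> \<Phi> \<Longrightarrow> clinear_functional \<phi>"
  shows "complex_vector.subspace (common_kernel \<Phi>)"
proof -
  have "complex_vector.subspace {x. \<phi> x = 0}" if "\<phi> \<in> \<Phi>" for \<phi>
  proof (rule complex_vector.subspaceI)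
    show "0 \<in> {x. \<phi> x = 0}" using clinear_functional_0[OF \<Phi>[OF that]] by simp
    show "x + y \<in> {x. \<phi> x = 0}" if "x \<in> {x. \<phi> x = 0}" "y \<in> {x. \<phi> x = 0}" for x y
      using \<Phi>[OF \<open>\<phi> \<in> \<Phi>\<close>] that by (simp add: clinear_functional_def)
    show "c *\<^sub>C x \<in> {x. \<phi> x = 0}" if "x \<in> {x. \<phi> x = 0}" for c x
      using \<Phi>[OF \<open>\<phi> \<in> \<Phi>\<close>] that by (simp add: clinear_functional_def)
  qed
  then have "complex_vector.subspace (\<Inter>\<phi>\<in>\<Phi>. {x. \<phi> x = 0})"
    by (intro complex_vector.subspace_Inter) auto
  moreover have "common_kernel \<Phi> = (\<Inter>\<phi>\<in>\<Phi>. {x. \<phi> x = 0})" by (auto simp: common_kernel_def)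
  ultimately show ?thesis by simp
qed

lemma infinite_dimensional_kernel:
  assumes E: "complex_vector.subspace E" "infinite_dimensional E" and \<phi>: "clinear_functional \<phi>"
  shows "infinite_dimensional (E \<inter> {x. \<phi> x = 0})"
proof (cases "\<exists>y\<in>E. \<phi> y \<noteq> 0")
  case False
  then have "E \<inter> {x. \<phi> x = 0} = E" by auto
  then show ?thesis using E by simp
next
  case True
  then obtain y where y: "y \<in> E" "\<phi> y \<noteq> 0" by auto
  show ?thesis unfolding infinite_dimensional_def
  proof
    assume "\<exists>B. finite B \<and> complex_vector.span B = E \<inter> {x. \<phi> x = 0}"
    then obtain B where B: "finite B" "complex_vector.span B = E \<inter> {x. \<phi> x = 0}" by auto
    have "x \<in> E \<longleftrightarrow> x \<in> complex_vector.span (insert y B)" for x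
    proof
      assume x: "x \<in> E"
      let ?k = "\<phi> x / \<phi> y"
      have "x - ?k *\<^sub>C y \<in> E"
        using E(1) x y by (intro complex_vector.subspace_diff complex_vector.subspace_scale)
      moreover have "\<phi> (x - ?k *\<^sub>C y) + \<phi> (?k *\<^sub>C y) = \<phi> x"
        using \<phi> unfolding clinear_functional_def by (metis diff_add_cancel)
      then have "\<phi> (x - ?k *\<^sub>C y) = 0"
        using \<phi> y unfolding clinear_functional_def by simp
      ultimately show "x \<in> complex_vector.span (insert y B)"
        unfolding complex_vector.span_breakdown_eq B(2) by blast
    next
      have "B \<subseteq> E" using B(2) complex_vector.span_superset[of B] by auto
      then have "complex_vector.span (insert y B) \<subseteq> E"
        using y E(1) by (intro complex_vector.span_minimal) auto
      then show "x \<in> complex_vector.span (insert y B) \<Longrightarrow> x \<in> E" by auto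
    qed
    then have "complex_vector.span (insert y B) = E" by auto
    then show False using E(2) B(1) unfolding infinite_dimensional_def by blast
  qed
qed

lemma unit_vector_in_kernel:
  assumes E: "complex_vector.subspace E" "infinite_dimensional E"
    and "finite \<Phi>" "\<And>\<phi>. \<phi> \<in> \<Phi> \<Longrightarrow> clinear_functional \<phi>"
  obtains e where "e \<in> E" "norm e = 1" "e \<in> common_kernel \<Phi>"
proof -
  have sub: "complex_vector.subspace (E \<inter> common_kernel \<Psi>)" if "\<Psi> \<subseteq> \<Phi>" for \<Psi>
    using assms that by (intro complex_vector.subspace_inter subspace_common_kernel) auto
  have "infinite_dimensional (E \<inter> common_kernel \<Phi>)"
    using assms(3) sub assms(4)
  proof (induction \<Phi>)
    case (insert \<phi> \<Phi>)
    have "infinite_dimensional ((E \<inter> common_kernel \<Phi>) \<inter> {x. \<phi> x = 0})"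
      using insert by (intro infinite_dimensional_kernel) auto
    then show ?case by (simp add: common_kernel_def Int_def conj_ac)
  qed (simp add: common_kernel_def E)
  moreover have "complex_vector.span {} = {0::'a}" by simp
  ultimately have "E \<inter> common_kernel \<Phi> \<noteq> {0}"
    unfolding infinite_dimensional_def by (metis finite.emptyI)
  moreover have "0 \<in> E \<inter> common_kernel \<Phi>" using complex_vector.subspace_0[OF sub] by blast
  ultimately obtain x where x: "x \<in> E \<inter> common_kernel \<Phi>" "x \<noteq> 0" by auto
  then have "complex_of_real (1 / norm x) *\<^sub>C x \<in> E \<inter> common_kernel \<Phi>"
    using complex_vector.subspace_scale[OF sub] by blast
  moreover have "norm (complex_of_real (1 / norm x) *\<^sub>C x) = 1" 
    using x by (simp add: norm_scaleC norm_divide)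
  ultimately show thesis by (intro that) auto
qed

section \<open>Vectors with simultaneously recurrent orbits\<close>

lemma bounded_linear_funpow: "bounded_linear (blinfun_apply (T :: 'a::real_normed_vector \<Rightarrow>\<^sub>L 'a) ^^ n)"
proof (induction n)
  case (Suc n)
  show ?case using bounded_linear_compose[OF blinfun.bounded_linear_right Suc.IH] by (simp add: o_def)
qed (simp add: bounded_linear_ident id_def)

text \<open>
Basic neighbourhoods in the topology of pointwise convergence of sequences.
\<close>

lemma product_neighbourhood:
  fixes U :: "(nat \<Rightarrow> 'a::metric_space) set"
  assumes "open U" "x \<in> U"
  obtains N e where "0 < e" "\<And>y. (\<And>i. i < N \<Longrightarrow> dist (y i) (x i) < e) \<Longrightarrow> y \<in> U"
proof -
  obtain X where X: "x \<in> Pi\<^sub>E UNIV X" "\<And>i. open (X i)" "finite {i. X i \<noteq> UNIV}" "Pi\<^sub>E UNIV X \<subseteq> U"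
    using product_topology_open_contains_basis[of "\<lambda>_. euclidean" UNIV U x] assms
    unfolding open_fun_def by auto
  have "\<exists>e>0. ball (x i) e \<subseteq> X i" for i
    using X(1,2) by (meson PiE_mem UNIV_I open_contains_ball)
  then obtain r where r: "\<And>i. 0 < r i" "\<And>i. ball (x i) (r i) \<subseteq> X i" by metis
  obtain N where N: "{i. X i \<noteq> UNIV} \<subseteq> {..<N}" using X(3) finite_nat_iff_bounded by blast
  let ?e = "Min (insert 1 (r ` {..<N}))"
  show thesis
  proof
    show "0 < ?e" using r(1) by auto
    fix y assume y: "\<And>i. i < N \<Longrightarrow> dist (y i) (x i) < ?e"
    have "y i \<in> X i" for i
    proof (cases "i < N")
      case True
      then have "?e \<le> r i" by (intro Min_le) auto
      then have "y i \<in> ball (x i) (r i)" using y[OF True] True by (simp add: dist_commute)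
      then show ?thesis using r(2) by blast
    next
      case False
      then show ?thesis using N by auto
    qed
    then show "y \<in> U" using X(4) by auto
  qed
qed

lemma closure_eq_UNIV_I:
  assumes "\<And>x U. open U \<Longrightarrow> x \<in> U \<Longrightarrow> S \<inter> U \<noteq> {}"
  shows "closure S = UNIV"
  using assms[of "- closure S"] closure_subset[of S] by fast

text \<open>
Membership in \<open>\<Omega>(T)\<close> provides one sequence of exponents for all vectors of a dense set, so
finitely many of them are recurrent at the same time.
\<close>

lemma Omega_limits_simultaneous:
  assumes h: "h \<in> Omega_limits T"
  obtains D where "closure D = UNIV"
    "\<And>y N m \<epsilon>. (\<And>i::nat. i < N \<Longrightarrow> y i \<in> D) \<Longrightarrow> 0 < \<epsilon> \<Longrightarrow>
      \<exists>k>m. \<forall>i<N. norm ((blinfun_apply T ^^ k) (y i) - blinfun_apply h (y i)) < \<epsilon>"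
proof -
  from h obtain \<omega> where \<omega>: "pos_strict_seq \<omega>"
    "closure {x. (\<lambda>n. (blinfun_apply T ^^ \<omega> n) x) \<longlonglongrightarrow> blinfun_apply h x} = UNIV"
    unfolding Omega_limits_def by auto
  show thesis
  proof (rule that[OF \<omega>(2)])
    fix y :: "nat \<Rightarrow> 'a" and N m :: nat and \<epsilon> :: real
    assume y: "\<And>i. i < N \<Longrightarrow> y i \<in> {x. (\<lambda>n. (blinfun_apply T ^^ \<omega> n) x) \<longlonglongrightarrow> blinfun_apply h x}"
      and \<epsilon>: "0 < \<epsilon>"
    have "\<forall>i\<in>{..<N}. \<forall>\<^sub>F n in sequentially. norm ((blinfun_apply T ^^ \<omega> n) (y i) - blinfun_apply h (y i)) < \<epsilon>"
      using y \<epsilon> unfolding tendsto_iff dist_norm by auto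
    then have "\<forall>\<^sub>F n in sequentially. \<forall>i\<in>{..<N}. norm ((blinfun_apply T ^^ \<omega> n) (y i) - blinfun_apply h (y i)) < \<epsilon>"
      by (intro eventually_ball_finite) auto
    then obtain n0 where n0: "\<And>n. n \<ge> n0 \<Longrightarrow> \<forall>i\<in>{..<N}. norm ((blinfun_apply T ^^ \<omega> n) (y i) - blinfun_apply h (y i)) < \<epsilon>"
      unfolding eventually_sequentially by blast
    have "max n0 (Suc m) \<le> \<omega> (max n0 (Suc m))"
      using \<omega>(1) unfolding pos_strict_seq_def by (intro strict_mono_imp_increasing) auto
    then show "\<exists>k>m. \<forall>i<N. norm ((blinfun_apply T ^^ k) (y i) - blinfun_apply h (y i)) < \<epsilon>"
      using n0[of "max n0 (Suc m)"] by (intro exI[of _ "\<omega> (max n0 (Suc m))"]) auto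
  qed
qed

text \<open>
Sequences \<open>d\<close> with these properties are generic in the product space. The dense sets furnished by the
individual operators \<open>H n\<close> may be disjoint; passing to sequences of vectors nevertheless gives one dense
set that serves all of them.
\<close>

lemma common_dense_sequence:
  fixes H :: "nat \<Rightarrow> 'a::complex_banach \<Rightarrow>\<^sub>L 'a"
  assumes sep: "separable_space (euclidean :: 'a topology)"
    and H: "\<And>n. H n \<in> Omega_limits T"
  obtains d :: "nat \<Rightarrow> 'a" where "closure (range d) = UNIV"
    "\<forall>n N m. \<forall>\<epsilon>>0. \<exists>k>m. \<forall>i<N. norm ((blinfun_apply T ^^ k) (d i) - blinfun_apply (H n) (d i)) < \<epsilon>"
proof -
  obtain C :: "'a set" where C: "countable C" "closure C = UNIV"
    using sep unfolding separable_space_def by auto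
  then have "C \<noteq> {}" by auto
  define c where "c = from_nat_into C"
  have c: "closure (range c) = UNIV" using C \<open>C \<noteq> {}\<close> by (simp add: c_def range_from_nat_into)
  define near where "near q = {x :: nat \<Rightarrow> 'a. \<exists>i. dist (x i) (c (fst q)) < 1 / Suc (snd q)}" for q
  define rec where "rec n N m = {x :: nat \<Rightarrow> 'a. \<exists>k>m. \<forall>i<N.
     norm ((blinfun_apply T ^^ k) (x i) - blinfun_apply (H n) (x i)) < 1 / Suc m}" for n N m
  let ?rec = "\<lambda>(n, N, m). rec n N m"
  let ?G = "range near \<union> range ?rec"
  have open_near: "open (near q)" for q
  proof -
    have "near q = (\<Union>i. {x. dist (x i) (c (fst q)) < 1 / Suc (snd q)})" by (auto simp: near_def)
    also have "open \<dots>" by (intro open_UN ballI open_Collect_less continuous_intros) auto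
    finally show ?thesis .
  qed
  have open_rec: "open (rec n N m)" for n N m
  proof -
    have cont: "continuous_on UNIV (\<lambda>x :: nat \<Rightarrow> 'a. (blinfun_apply T ^^ k) (x i))" for k i
      by (rule bounded_linear.continuous_on[OF bounded_linear_funpow]) simp
    have "rec n N m = (\<Union>k\<in>{m<..}. \<Inter>i\<in>{..<N}.
       {x. norm ((blinfun_apply T ^^ k) (x i) - blinfun_apply (H n) (x i)) < 1 / Suc m})"
      by (auto simp: rec_def)
    also have "open \<dots>"
      by (intro open_UN open_INT ballI open_Collect_less continuous_intros cont) auto
    finally show ?thesis .
  qed
  have dense_near: "closure (near q) = UNIV" for q
  proof -
    have "near q \<inter> U \<noteq> {}" if U: "open U" "x \<in> U" for x U
    proof -
      obtain N e where "0 < e" and y: "\<And>y. (\<And>i. i < N \<Longrightarrow> dist (y i) (x i) < e) \<Longrightarrow> y \<in> U"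
        using product_neighbourhood[OF U] by metis
      \<comment> \<open>the coordinate \<open>N\<close> is not constrained by the neighbourhood\<close>
      then have "x(N := c (fst q)) \<in> U" by (intro y) auto
      moreover have "x(N := c (fst q)) \<in> near q" by (auto simp: near_def intro!: exI[of _ N])
      ultimately show ?thesis by blast
    qed
    then show ?thesis by (rule closure_eq_UNIV_I)
  qed
  have dense_rec: "closure (rec n N m) = UNIV" for n N m
  proof -
    obtain D where D: "closure D = UNIV"
      "\<And>y N m \<epsilon>. (\<And>i::nat. i < N \<Longrightarrow> y i \<in> D) \<Longrightarrow> 0 < \<epsilon> \<Longrightarrow>
        \<exists>k>m. \<forall>i<N. norm ((blinfun_apply T ^^ k) (y i) - blinfun_apply (H n) (y i)) < \<epsilon>"
      using Omega_limits_simultaneous[OF H[of n]] by metis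
    have "rec n N m \<inter> U \<noteq> {}" if U: "open U" "x \<in> U" for x U
    proof -
      obtain N' e where e: "0 < e" and y: "\<And>y. (\<And>i. i < N' \<Longrightarrow> dist (y i) (x i) < e) \<Longrightarrow> y \<in> U"
        using product_neighbourhood[OF U] by metis
      have "\<exists>z\<in>D. dist z (x i) < e" for i
        using D(1) e closure_approachable[of "x i" D] by auto
      then obtain z where z: "\<And>i. z i \<in> D" "\<And>i. dist (z i) (x i) < e" by metis
      have "z \<in> U" using y z by blast
      moreover have "z \<in> rec n N m" using D(2)[of N z "1 / Suc m" m] z(1) by (simp add: rec_def)
      ultimately show ?thesis by blast
    qed
    then show ?thesis by (rule closure_eq_UNIV_I)
  qed
  have "Met_TC.mtopology closure_of \<Inter>?G = (UNIV :: (nat \<Rightarrow> 'a) set)"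
  proof (rule Met_TC.metric_Baire_category)
    show "Met_TC.mcomplete TYPE(nat \<Rightarrow> 'a)" by (simp add: complete_UNIV)
    show "openin Met_TC.mtopology A \<and> Met_TC.mtopology closure_of A = UNIV" if "A \<in> ?G" for A
      using that open_near open_rec dense_near dense_rec by auto
  qed auto
  then have "\<Inter>?G \<noteq> {}" by (metis closure_of_empty UNIV_not_empty)
  then obtain d where "d \<in> \<Inter>?G" by auto
  then have "d \<in> near q" "d \<in> ?rec (n, N, m)" for q n N m by blast+
  then have d: "d \<in> near q" "d \<in> rec n N m" for q n N m by auto
  show thesis
  proof (rule that[of d])
    show "closure (range d) = UNIV"
    proof -
      have "\<exists>y\<in>range d. dist y x < e" if "0 < e" for x e
      proof -
        have "\<exists>y\<in>range c. dist y x < e / 2"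
          using c that by (intro closure_approachable[THEN iffD1, rule_format]) auto
        then obtain j where j: "dist (c j) x < e / 2" by blast
        obtain p where p: "1 / Suc p < e / 2"
          using nat_approx_posE[of "e / 2"] \<open>0 < e\<close> half_gt_zero by blast
        obtain i where "dist (d i) (c j) < 1 / Suc p" using d(1)[of "(j, p)"] by (auto simp: near_def)
        then have "dist (d i) x < e" using j p dist_triangle[of "d i" x "c j"] by linarith
        then show ?thesis by blast
      qed
      then show ?thesis by (auto simp: closure_approachable)
    qed
    show "\<forall>n N m. \<forall>\<epsilon>>0. \<exists>k>m. \<forall>i<N. norm ((blinfun_apply T ^^ k) (d i) - blinfun_apply (H n) (d i)) < \<epsilon>"
    proof (intro allI impI)
      fix n N m and \<epsilon> :: real assume "0 < \<epsilon>"
      then obtain p where p: "1 / Suc p < \<epsilon>" using nat_approx_posE by blast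
      have "1 / Suc (max m p) \<le> 1 / Suc p" by (intro divide_left_mono) auto
      moreover obtain k where "k > max m p"
        "\<forall>i<N. norm ((blinfun_apply T ^^ k) (d i) - blinfun_apply (H n) (d i)) < 1 / Suc (max m p)"
        using d(2)[of n N "max m p"] by (auto simp: rec_def)
      ultimately show "\<exists>k>m. \<forall>i<N. norm ((blinfun_apply T ^^ k) (d i) - blinfun_apply (H n) (d i)) < \<epsilon>"
        using p by (intro exI[of _ k]) (auto intro: less_trans less_le_trans)
    qed
  qed
qed

section \<open>Directions in which the powers are bounded\<close>

lemma operator_power_scaleC:
  assumes "T \<in> complex_operators"
  shows "(blinfun_apply T ^^ n) (c *\<^sub>C x) = c *\<^sub>C (blinfun_apply T ^^ n) x"
  using assms by (induction n) (auto simp: complex_operators_def)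

lemma roots_of_unity_orthogonal:
  fixes i k N :: nat
  assumes "i < N" "k < N"
  shows "(\<Sum>j<N. cis (2 * pi * i / N) ^ j * cis (- (2 * pi * k / N)) ^ j) = (if i = k then of_nat N else 0)"
proof -
  define w where "w = cis (2 * pi * i / N) * cis (- (2 * pi * k / N))"
  have N: "real N > 0" using assms by simp
  have w: "w = cis (2 * pi * ((real i - real k) / N))"
    unfolding w_def cis_mult by (rule arg_cong[of _ _ cis]) (simp add: diff_divide_distrib right_diff_distrib)
  have "w ^ N = cis (2 * pi * of_int (int i - int k))"
    using N unfolding w Complex.DeMoivre by (intro arg_cong[of _ _ cis]) simp
  then have wN: "w ^ N = 1" by (simp only: cis_multiple_2pi[OF Ints_of_int])
  have "(\<Sum>j<N. w ^ j) = (if i = k then of_nat N else 0)"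
  proof (cases "i = k")
    case True
    then show ?thesis by (simp add: w)
  next
    case False
    have "w \<noteq> 1"
    proof
      assume "w = 1"
      then have "cos (2 * pi * ((real i - real k) / N)) = 1" by (simp add: w complex_eq_iff)
      then obtain m :: int where "2 * pi * ((real i - real k) / N) = of_int m * 2 * pi"
        using cos_one_2pi_int by blast
      then have "pi * (2 * ((real i - real k) / N)) = pi * (2 * of_int m)" by (simp add: mult_ac)
      then have "(real i - real k) / N = of_int m"
        by (simp only: mult_cancel_left) simp
      then have "real i - real k = of_int m * N" using N by (simp add: field_simps)
      then have "real_of_int (int i - int k) = real_of_int (m * int N)" by simp
      then have "int i - int k = m * int N" by (simp only: of_int_eq_iff)
      then have "int N dvd int i - int k" by simp
      moreover have "\<bar>int i - int k\<bar> < int N" using assms by linarith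
      ultimately show False using False using dvd_imp_le_int[of "int i - int k" "int N"] by simp
    qed
    then show ?thesis using False wN by (simp add: geometric_sum)
  qed
  then show ?thesis by (simp only: w_def power_mult_distrib)
qed

text \<open>
A lower bound for all \<open>T - \<mu>\<close> with \<open>\<mu>\<close> on the unit circle bounds the inner part of an orbit segment by
its two ends.
\<close>

lemma orbit_bound_by_averaging:
  fixes T :: "'a::complex_banach \<Rightarrow>\<^sub>L 'a" and L :: "'a set"
  assumes T: "T \<in> complex_operators" and L: "complex_vector.subspace L"
    and c: "0 < c" "\<And>\<mu> y. cmod \<mu> = 1 \<Longrightarrow> y \<in> L \<Longrightarrow> c * norm y \<le> norm (blinfun_apply T y - \<mu> *\<^sub>C y)"
    and x: "\<And>i. i < N \<Longrightarrow> (blinfun_apply T ^^ i) x \<in> L" and k: "k < N"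
  shows "norm ((blinfun_apply T ^^ k) x) \<le> (norm ((blinfun_apply T ^^ N) x) + norm x) / c"
proof -
  let ?T = "\<lambda>i. (blinfun_apply T ^^ i) x"
  let ?B = "(norm (?T N) + norm x) / c"
  define z where "z j = cis (2 * pi * j / N)" for j :: nat
  \<comment> \<open>By \<open>z j ^ N = 1\<close> the sum \<open>z j *\<^sub>C T (u j) - u j\<close> telescopes to \<open>T ^^ N - id\<close>, applied to \<open>x\<close>.\<close>
  define u where "u j = (\<Sum>i<N. z i ^ j *\<^sub>C ?T i)" for j
  have N: "real N > 0" using k by simp
  have z: "z i ^ j = z j ^ i" for i j unfolding z_def Complex.DeMoivre by (rule arg_cong[of _ _ cis]) simp
  have zN: "z j ^ N = 1" for j
  proof -
    have "z j ^ N = cis (2 * pi * of_int (int j))"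
      using N unfolding z_def Complex.DeMoivre by (intro arg_cong[of _ _ cis]) simp
    then show ?thesis by (simp only: cis_multiple_2pi[OF Ints_of_int])
  qed
  have cz: "cmod (z j) = 1" for j by (simp add: z_def)
  have u_le: "norm (u j) \<le> ?B" for j
  proof -
    have "u j \<in> L" unfolding u_def
      using x by (intro complex_vector.subspace_sum[OF L] complex_vector.subspace_scale[OF L]) auto
    have "z j *\<^sub>C blinfun_apply T (u j) = (\<Sum>i<N. z j ^ Suc i *\<^sub>C ?T (Suc i))"
      using T by (simp add: u_def blinfun.sum_right complex_vector.scale_sum_right z complex_operators_def)
    moreover have "u j = (\<Sum>i<N. z j ^ i *\<^sub>C ?T i)" by (simp add: u_def z)
    ultimately have "z j *\<^sub>C blinfun_apply T (u j) - u j
        = (\<Sum>i<N. z j ^ Suc i *\<^sub>C ?T (Suc i) - z j ^ i *\<^sub>C ?T i)"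
      by (simp only: sum_subtractf)
    also have "\<dots> = z j ^ N *\<^sub>C ?T N - x"
      by (subst sum_lessThan_telescope) simp
    finally have e: "z j *\<^sub>C blinfun_apply T (u j) - u j = ?T N - x" by (simp add: zN)
    have "blinfun_apply T (u j) - inverse (z j) *\<^sub>C u j = inverse (z j) *\<^sub>C (z j *\<^sub>C blinfun_apply T (u j) - u j)"
      using cz[of j] by (cases "z j = 0") (auto simp: complex_vector.scale_right_diff_distrib)
    then have "norm (blinfun_apply T (u j) - inverse (z j) *\<^sub>C u j) = norm (?T N - x)"
      by (simp only: e) (simp add: norm_scaleC norm_inverse cz)
    then have "c * norm (u j) \<le> norm (?T N - x)"
      using c(2)[of "inverse (z j)", OF _ \<open>u j \<in> L\<close>] cz[of j] by (simp add: norm_inverse)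
    also have "\<dots> \<le> norm (?T N) + norm x" by (rule norm_triangle_ineq4)
    finally show ?thesis using c(1) by (simp add: field_simps)
  qed
  have "(\<Sum>j<N. cis (- (2 * pi * k / N)) ^ j *\<^sub>C u j)
      = (\<Sum>i<N. (\<Sum>j<N. z i ^ j * cis (- (2 * pi * k / N)) ^ j) *\<^sub>C ?T i)"
    unfolding u_def complex_vector.scale_sum_right complex_vector.scale_sum_left
    by (subst sum.swap) (simp add: mult.commute)
  also have "\<dots> = (\<Sum>i<N. if i = k then of_nat N *\<^sub>C ?T i else 0)"
  proof (rule sum.cong[OF refl])
    fix i assume "i \<in> {..<N}"
    then have "(\<Sum>j<N. z i ^ j * cis (- (2 * pi * k / N)) ^ j) = (if i = k then of_nat N else 0)"
      unfolding z_def using k by (intro roots_of_unity_orthogonal) auto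
    then show "(\<Sum>j<N. z i ^ j * cis (- (2 * pi * k / N)) ^ j) *\<^sub>C ?T i
        = (if i = k then of_nat N *\<^sub>C ?T i else 0)" by (simp only:) simp
  qed
  also have "\<dots> = of_nat N *\<^sub>C ?T k"
    using k by simp
  finally have "N * norm (?T k) = norm (\<Sum>j<N. cis (- (2 * pi * k / N)) ^ j *\<^sub>C u j)"
    by (simp add: norm_scaleC)
  also have "\<dots> \<le> (\<Sum>j<N. ?B)"
    by (rule sum_norm_le) (simp add: norm_scaleC norm_power u_le)
  also have "\<dots> = N * ?B" by simp
  finally show ?thesis by (rule mult_left_le_imp_le[OF _ N])
qed

text \<open>
The powers of \<open>T\<close> are bounded in many directions: in each subspace of finite codimension there are unit
vectors \<open>e\<close> at which any finite number of powers \<open>T\<^sup>k\<close> almost agree with linear maps \<open>A k\<close>, where \<open>A k\<close>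
has norm at most \<open>C\<close> on a subspace \<open>V k\<close> that contains \<open>e\<close>. The maps \<open>A k\<close> and the subspaces \<open>V k\<close>
allow a common treatment of the two cases of the dichotomy: in one, \<open>A k\<close> is a scalar and \<open>V k\<close> the whole
space; in the other, \<open>A k\<close> is \<open>T\<^sup>k\<close> itself.
\<close>

definition bounded_directions ::
  "('a::complex_banach \<Rightarrow>\<^sub>L 'a) \<Rightarrow> real \<Rightarrow> (nat \<Rightarrow> 'a \<Rightarrow> 'a) \<Rightarrow> (nat \<Rightarrow> 'a set) \<Rightarrow> bool" where
  "bounded_directions T C A V \<longleftrightarrow>
     (\<forall>k. complex_vector.subspace (V k)) \<and>
     (\<forall>k x y. A k (x + y) = A k x + A k y) \<and> (\<forall>k c x. A k (c *\<^sub>C x) = c *\<^sub>C A k x) \<and>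
     (\<forall>k. \<forall>x\<in>V k. norm (A k x) \<le> C * norm x) \<and>
     (\<forall>\<Phi> K \<epsilon>. finite \<Phi> \<longrightarrow> (\<forall>\<phi>\<in>\<Phi>. clinear_functional \<phi>) \<longrightarrow> finite K \<longrightarrow> 0 < \<epsilon> \<longrightarrow>
        (\<exists>e\<in>common_kernel \<Phi>. norm e = 1 \<and>
           (\<forall>k\<in>K. e \<in> V k \<and> norm ((blinfun_apply T ^^ k) e - A k e) \<le> \<epsilon>)))"

lemma bounded_directionsD:
  assumes "bounded_directions T C A V"
  shows "complex_vector.subspace (V k)" "A k (x + y) = A k x + A k y" "A k (c *\<^sub>C x) = c *\<^sub>C A k x"
    "x \<in> V k \<Longrightarrow> norm (A k x) \<le> C * norm x"
proof -
  note dir = assms[unfolded bounded_directions_def]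
  show "complex_vector.subspace (V k)" by (rule dir[THEN conjunct1, THEN spec])
  show "A k (x + y) = A k x + A k y" by (rule dir[THEN conjunct2, THEN conjunct1, rule_format])
  show "A k (c *\<^sub>C x) = c *\<^sub>C A k x"
    by (rule dir[THEN conjunct2, THEN conjunct2, THEN conjunct1, rule_format])
  show "x \<in> V k \<Longrightarrow> norm (A k x) \<le> C * norm x"
    by (rule dir[THEN conjunct2, THEN conjunct2, THEN conjunct2, THEN conjunct1, rule_format])
qed

lemma bounded_directions_vector:
  assumes "bounded_directions T C A V" "finite \<Phi>" "\<And>\<phi>. \<phi> \<in> \<Phi> \<Longrightarrow> clinear_functional \<phi>" "finite K" "0 < \<epsilon>"
  obtains e where "e \<in> common_kernel \<Phi>" "norm e = 1"
    "\<And>k. k \<in> K \<Longrightarrow> e \<in> V k \<and> norm ((blinfun_apply T ^^ k) e - A k e) \<le> \<epsilon>"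
proof -
  have "\<forall>\<phi>\<in>\<Phi>. clinear_functional \<phi>" using assms(3) by blast
  with assms(1,2,4,5) show thesis unfolding bounded_directions_def using that by meson
qed

text \<open>
Approximate eigenvalues that remain so on every subspace of finite codimension: no restriction of
\<open>T - \<mu>\<close> to such a subspace is bounded below.
\<close>

definition approximate_eigenvalue_off_finite_codim ::
  "('a::complex_banach \<Rightarrow>\<^sub>L 'a) \<Rightarrow> complex \<Rightarrow> bool" where
  "approximate_eigenvalue_off_finite_codim T \<mu> \<longleftrightarrow>
     (\<forall>\<Phi> \<epsilon>. finite \<Phi> \<longrightarrow> (\<forall>\<phi>\<in>\<Phi>. clinear_functional \<phi>) \<longrightarrow> 0 < \<epsilon> \<longrightarrow>
        (\<exists>e\<in>common_kernel \<Phi>. norm e = 1 \<and> norm (blinfun_apply T e - \<mu> *\<^sub>C e) < \<epsilon>))"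

lemma power_minus_scalar_bound:
  assumes T: "T \<in> complex_operators" and \<mu>: "cmod \<mu> = 1"
  shows "\<exists>c\<ge>0. \<forall>x. norm ((blinfun_apply T ^^ k) x - \<mu> ^ k *\<^sub>C x) \<le> c * norm (blinfun_apply T x - \<mu> *\<^sub>C x)"
proof (induction k)
  case (Suc k)
  then obtain c where c: "c \<ge> 0"
    "\<And>x. norm ((blinfun_apply T ^^ k) x - \<mu> ^ k *\<^sub>C x) \<le> c * norm (blinfun_apply T x - \<mu> *\<^sub>C x)" by blast
  have "norm ((blinfun_apply T ^^ Suc k) x - \<mu> ^ Suc k *\<^sub>C x)
      \<le> (norm T * c + 1) * norm (blinfun_apply T x - \<mu> *\<^sub>C x)" for x
  proof -
    have "(blinfun_apply T ^^ Suc k) x - \<mu> ^ Suc k *\<^sub>C x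
        = blinfun_apply T ((blinfun_apply T ^^ k) x - \<mu> ^ k *\<^sub>C x) + \<mu> ^ k *\<^sub>C (blinfun_apply T x - \<mu> *\<^sub>C x)"
      using T by (simp add: blinfun.diff_right complex_vector.scale_right_diff_distrib complex_operators_def mult.commute)
    also have "norm \<dots> \<le> norm T * norm ((blinfun_apply T ^^ k) x - \<mu> ^ k *\<^sub>C x)
        + norm (\<mu> ^ k *\<^sub>C (blinfun_apply T x - \<mu> *\<^sub>C x))"
      by (rule order_trans[OF norm_triangle_ineq add_right_mono[OF norm_blinfun]])
    also have "\<dots> \<le> norm T * (c * norm (blinfun_apply T x - \<mu> *\<^sub>C x)) + norm (blinfun_apply T x - \<mu> *\<^sub>C x)"
      using c(2)[of x] by (intro add_mono mult_left_mono) (auto simp: norm_scaleC norm_power \<mu>)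
    finally show ?thesis by (simp add: algebra_simps)
  qed
  then show ?case using c(1) by (intro exI[of _ "norm T * c + 1"]) auto
qed (auto intro!: exI[of _ 0])

lemma bounded_directions_approximate_eigenvalue:
  assumes T: "T \<in> complex_operators" and \<mu>: "cmod \<mu> = 1"
    and ev: "approximate_eigenvalue_off_finite_codim T \<mu>"
  shows "bounded_directions T 1 (\<lambda>k x. \<mu> ^ k *\<^sub>C x) (\<lambda>_. UNIV)"
proof -
  have "\<exists>e\<in>common_kernel \<Phi>. norm e = 1 \<and> (\<forall>k\<in>K. norm ((blinfun_apply T ^^ k) e - \<mu> ^ k *\<^sub>C e) \<le> \<epsilon>)"
    if "finite \<Phi>" "\<forall>\<phi>\<in>\<Phi>. clinear_functional \<phi>" "finite K" "0 < \<epsilon>" for \<Phi> K and \<epsilon> :: real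
  proof -
    obtain c where c: "\<And>k. 0 \<le> c k"
      "\<And>k x. norm ((blinfun_apply T ^^ k) x - \<mu> ^ k *\<^sub>C x) \<le> c k * norm (blinfun_apply T x - \<mu> *\<^sub>C x)"
      using power_minus_scalar_bound[OF T \<mu>] by metis
    let ?s = "1 + (\<Sum>k\<in>K. c k)"
    have s: "0 < ?s" using c(1) by (simp add: add_pos_nonneg sum_nonneg)
    then have "0 < \<epsilon> / ?s" using \<open>0 < \<epsilon>\<close> by simp
    with ev that(1,2)
    obtain e where e: "e \<in> common_kernel \<Phi>" "norm e = 1" "norm (blinfun_apply T e - \<mu> *\<^sub>C e) < \<epsilon> / ?s"
      unfolding approximate_eigenvalue_off_finite_codim_def by blast
    have "norm ((blinfun_apply T ^^ k) e - \<mu> ^ k *\<^sub>C e) \<le> \<epsilon>" if k: "k \<in> K" for k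
    proof -
      have "c k \<le> ?s" using member_le_sum[OF k, of c] c(1) \<open>finite K\<close> by simp
      then have "c k * norm (blinfun_apply T e - \<mu> *\<^sub>C e) \<le> ?s * (\<epsilon> / ?s)"
        using e(3) c(1) s by (intro mult_mono) auto
      then show ?thesis using c(2)[of k e] s by simp
    qed
    then show ?thesis using e by blast
  qed
  moreover have "complex_vector.subspace (UNIV :: 'a set)" by (simp add: complex_vector.subspace_UNIV)
  moreover have "\<mu> ^ k *\<^sub>C c *\<^sub>C x = c *\<^sub>C \<mu> ^ k *\<^sub>C x" for k c and x :: 'a
    by (simp only: scaleC_scaleC mult.commute)
  moreover have "norm (\<mu> ^ k *\<^sub>C x) = norm x" for k and x :: 'a
    by (simp add: norm_scaleC norm_power \<mu>)
  ultimately show ?thesis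
    unfolding bounded_directions_def by (simp only: scaleC_add_right) simp
qed

text \<open>
Each \<open>\<mu>\<close> comes with its own bound and finite set of functionals, and these still serve for nearby
scalars; finitely many of them suffice by compactness of the circle.
\<close>

lemma uniformly_bounded_below_on_circle:
  assumes no: "\<And>\<mu>. cmod \<mu> = 1 \<Longrightarrow> \<not> approximate_eigenvalue_off_finite_codim T \<mu>"
    and T: "T \<in> complex_operators"
  obtains \<Phi> c where "finite \<Phi>" "\<And>\<phi>. \<phi> \<in> \<Phi> \<Longrightarrow> clinear_functional \<phi>" "0 < c"
    "\<And>\<mu> x. cmod \<mu> = 1 \<Longrightarrow> x \<in> common_kernel \<Phi> \<Longrightarrow> c * norm x \<le> norm (blinfun_apply T x - \<mu> *\<^sub>C x)"
proof -
  let ?S = "sphere (0::complex) 1"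
  have "\<exists>\<Phi> \<epsilon>. finite \<Phi> \<and> (\<forall>\<phi>\<in>\<Phi>. clinear_functional \<phi>) \<and> 0 < \<epsilon> \<and>
      (\<forall>e\<in>common_kernel \<Phi>. norm e = 1 \<longrightarrow> \<epsilon> \<le> norm (blinfun_apply T e - \<mu> *\<^sub>C e))" if "\<mu> \<in> ?S" for \<mu>
    using no[of \<mu>] that unfolding approximate_eigenvalue_off_finite_codim_def
    by (simp add: not_less)
  then obtain P r where P: "\<And>\<mu>. \<mu> \<in> ?S \<Longrightarrow> finite (P \<mu>)" "\<And>\<mu> \<phi>. \<mu> \<in> ?S \<Longrightarrow> \<phi> \<in> P \<mu> \<Longrightarrow> clinear_functional \<phi>"
    and r: "\<And>\<mu>. \<mu> \<in> ?S \<Longrightarrow> 0 < r \<mu>"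
      "\<And>\<mu> e. \<mu> \<in> ?S \<Longrightarrow> e \<in> common_kernel (P \<mu>) \<Longrightarrow> norm e = 1 \<Longrightarrow> r \<mu> \<le> norm (blinfun_apply T e - \<mu> *\<^sub>C e)"
    by metis
  have "?S \<subseteq> (\<Union>\<mu>\<in>?S. ball \<mu> (r \<mu> / 2))"
  proof
    fix \<mu> assume \<mu>: "\<mu> \<in> ?S"
    then have "\<mu> \<in> ball \<mu> (r \<mu> / 2)" using r(1) by simp
    then show "\<mu> \<in> (\<Union>\<mu>\<in>?S. ball \<mu> (r \<mu> / 2))" using \<mu> by blast
  qed
  then obtain D where D: "D \<subseteq> ?S" "finite D" "?S \<subseteq> (\<Union>\<mu>\<in>D. ball \<mu> (r \<mu> / 2))"
    by (rule compactE_image[OF compact_sphere open_ball])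
  have "1 \<in> ?S" by simp
  then have "D \<noteq> {}" using D(3) by blast
  define \<Phi> where "\<Phi> = (\<Union>\<mu>\<in>D. P \<mu>)"
  define c where "c = Min ((\<lambda>\<mu>. r \<mu> / 2) ` D)"
  have clin: "\<And>\<phi>. \<phi> \<in> \<Phi> \<Longrightarrow> clinear_functional \<phi>"
    using D(1) P(2) unfolding \<Phi>_def by blast
  have c: "0 < c" unfolding c_def using D \<open>D \<noteq> {}\<close> r(1) by (subst Min_gr_iff) auto
  have unit: "c \<le> norm (blinfun_apply T e - \<mu> *\<^sub>C e)"
    if "cmod \<mu> = 1" "e \<in> common_kernel \<Phi>" "norm e = 1" for \<mu> e
  proof -
    have "\<mu> \<in> ?S" using that(1) by simp
    then obtain \<nu> where \<nu>: "\<nu> \<in> D" "\<mu> \<in> ball \<nu> (r \<nu> / 2)" using D(3) by blast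
    have "e \<in> common_kernel (P \<nu>)"
      using \<nu>(1) that(2) unfolding \<Phi>_def common_kernel_def by blast
    then have "r \<nu> \<le> norm (blinfun_apply T e - \<nu> *\<^sub>C e)"
      using \<nu>(1) D(1) that(3) by (intro r(2)) auto
    also have "blinfun_apply T e - \<nu> *\<^sub>C e = (blinfun_apply T e - \<mu> *\<^sub>C e) + (\<mu> - \<nu>) *\<^sub>C e"
      by (simp add: complex_vector.scale_left_diff_distrib)
    also have "norm \<dots> \<le> norm (blinfun_apply T e - \<mu> *\<^sub>C e) + cmod (\<mu> - \<nu>)"
      using norm_triangle_ineq[of _ "(\<mu> - \<nu>) *\<^sub>C e"] that(3) by (simp add: norm_scaleC)
    finally have "r \<nu> / 2 \<le> norm (blinfun_apply T e - \<mu> *\<^sub>C e)"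
      using \<nu>(2) by (simp add: dist_norm norm_minus_commute)
    moreover have "c \<le> r \<nu> / 2" unfolding c_def using \<nu>(1) D(2) by (intro Min_le) auto
    ultimately show ?thesis by simp
  qed
  show thesis
  proof
    show "finite \<Phi>" using D P(1) by (auto simp: \<Phi>_def)
    show "0 < c" by (rule c)
    fix \<mu> x assume x: "cmod \<mu> = 1" "x \<in> common_kernel \<Phi>"
    show "c * norm x \<le> norm (blinfun_apply T x - \<mu> *\<^sub>C x)"
    proof (cases "x = 0")
      case False
      let ?t = "complex_of_real (1 / norm x)"
      have "?t *\<^sub>C x \<in> common_kernel \<Phi>"
        using x(2) by (intro complex_vector.subspace_scale subspace_common_kernel clin)
      moreover have "norm (?t *\<^sub>C x) = 1" using False by (simp add: norm_scaleC norm_divide)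
      ultimately have "c \<le> norm (blinfun_apply T (?t *\<^sub>C x) - \<mu> *\<^sub>C ?t *\<^sub>C x)"
        by (rule unit[OF x(1)])
      also have "blinfun_apply T (?t *\<^sub>C x) - \<mu> *\<^sub>C ?t *\<^sub>C x = ?t *\<^sub>C (blinfun_apply T x - \<mu> *\<^sub>C x)"
      proof -
        have "blinfun_apply T (?t *\<^sub>C x) = ?t *\<^sub>C blinfun_apply T x"
          using T unfolding complex_operators_def by blast
        then show ?thesis by (simp only: complex_vector.scale_right_diff_distrib scaleC_scaleC mult.commute)
      qed
      also have "norm \<dots> = norm (blinfun_apply T x - \<mu> *\<^sub>C x) / norm x"
        by (simp add: norm_scaleC norm_divide)
      finally show ?thesis using False by (simp add: field_simps)
    qed simp
  qed (rule clin)
qed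

text \<open>
The subspace \<open>V k\<close> consists of the vectors of \<open>E\<close> whose orbit remains in the common kernel of \<open>\<Phi>\<close> before
the time \<open>\<theta> (Suc k) > k\<close>.
\<close>

lemma bounded_directions_bounded_below:
  fixes T :: "'a::complex_banach \<Rightarrow>\<^sub>L 'a"
  assumes T: "T \<in> complex_operators" and E: "complex_vector.subspace E" "infinite_dimensional E"
    and \<theta>: "strict_mono (\<theta> :: nat \<Rightarrow> nat)"
    and M: "\<And>n x. x \<in> E \<Longrightarrow> norm ((blinfun_apply T ^^ \<theta> n) x) \<le> M * norm x"
    and \<Phi>: "finite \<Phi>" "\<And>\<phi>. \<phi> \<in> \<Phi> \<Longrightarrow> clinear_functional \<phi>" and c: "0 < c"
    and below: "\<And>\<mu> x. cmod \<mu> = 1 \<Longrightarrow> x \<in> common_kernel \<Phi> \<Longrightarrow> c * norm x \<le> norm (blinfun_apply T x - \<mu> *\<^sub>C x)"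
  shows "bounded_directions T ((M + 1) / c) (\<lambda>k. blinfun_apply T ^^ k)
    (\<lambda>k. E \<inter> common_kernel ((\<lambda>(\<phi>, i). \<phi> \<circ> (blinfun_apply T ^^ i)) ` (\<Phi> \<times> {..<\<theta> (Suc k)})))"
    (is "bounded_directions T _ _ (\<lambda>k. E \<inter> common_kernel (?\<Psi> k))")
proof -
  have lin: "clinear_functional (\<phi> \<circ> (blinfun_apply T ^^ i))" if "\<phi> \<in> \<Phi>" for \<phi> i
    using \<Phi>(2)[OF that] operator_power_scaleC[OF T]
      linear_add[OF bounded_linear.linear[OF bounded_linear_funpow[of i T]]]
    by (simp add: clinear_functional_def)
  have \<Psi>: "finite (?\<Psi> k)" "\<And>\<psi>. \<psi> \<in> ?\<Psi> k \<Longrightarrow> clinear_functional \<psi>" for k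
  proof -
    show "finite (?\<Psi> k)" using \<Phi>(1) by (intro finite_imageI finite_cartesian_product) auto
    fix \<psi> assume "\<psi> \<in> ?\<Psi> k"
    then obtain \<phi> i where "\<phi> \<in> \<Phi>" "\<psi> = \<phi> \<circ> (blinfun_apply T ^^ i)" by auto
    then show "clinear_functional \<psi>" using lin by simp
  qed
  have "norm ((blinfun_apply T ^^ k) x) \<le> (M + 1) / c * norm x" if x: "x \<in> E \<inter> common_kernel (?\<Psi> k)" for k x
  proof -
    have "Suc k \<le> \<theta> (Suc k)" by (rule strict_mono_imp_increasing[OF \<theta>])
    then have k: "k < \<theta> (Suc k)" by simp
    have "(blinfun_apply T ^^ i) x \<in> common_kernel \<Phi>" if "i < \<theta> (Suc k)" for i
      unfolding common_kernel_def
    proof (intro CollectI ballI)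
      fix \<phi> assume "\<phi> \<in> \<Phi>"
      then have "\<phi> \<circ> (blinfun_apply T ^^ i) \<in> ?\<Psi> k"
        using that by (intro image_eqI[of _ _ "(\<phi>, i)"]) auto
      then have "(\<phi> \<circ> (blinfun_apply T ^^ i)) x = 0" using x unfolding common_kernel_def by blast
      then show "\<phi> ((blinfun_apply T ^^ i) x) = 0" by simp
    qed
    note orbit = this
    have "norm ((blinfun_apply T ^^ k) x) \<le> (norm ((blinfun_apply T ^^ \<theta> (Suc k)) x) + norm x) / c"
    proof (rule orbit_bound_by_averaging[where L = "common_kernel \<Phi>"])
      show "complex_vector.subspace (common_kernel \<Phi>)" by (rule subspace_common_kernel[OF \<Phi>(2)])
    qed (fact T c below orbit k)+
    also have "\<dots> \<le> (M * norm x + norm x) / c"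
      using M[of x "Suc k"] x c by (intro divide_right_mono add_right_mono) auto
    finally show ?thesis by (simp add: algebra_simps)
  qed
  moreover have "\<exists>e\<in>common_kernel \<Theta>. norm e = 1 \<and> (\<forall>k\<in>K. e \<in> E \<inter> common_kernel (?\<Psi> k))"
    if "finite \<Theta>" "\<forall>\<phi>\<in>\<Theta>. clinear_functional \<phi>" "finite K" for \<Theta> K
  proof -
    obtain e where "e \<in> E" "norm e = 1" "e \<in> common_kernel (\<Theta> \<union> (\<Union>k\<in>K. ?\<Psi> k))"
    proof (rule unit_vector_in_kernel[OF E])
      show "finite (\<Theta> \<union> (\<Union>k\<in>K. ?\<Psi> k))" using \<open>finite \<Theta>\<close> \<open>finite K\<close> \<Psi>(1) by (intro finite_UnI finite_UN_I)
      show "clinear_functional \<phi>" if "\<phi> \<in> \<Theta> \<union> (\<Union>k\<in>K. ?\<Psi> k)" for \<phi>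
        using that \<open>\<forall>\<phi>\<in>\<Theta>. clinear_functional \<phi>\<close> \<Psi>(2) by blast
    qed
    then show ?thesis unfolding common_kernel_def by blast
  qed
  moreover have "complex_vector.subspace (E \<inter> common_kernel (?\<Psi> k))" for k
    by (intro complex_vector.subspace_inter E subspace_common_kernel \<Psi>)
  moreover have "(blinfun_apply T ^^ k) (x + y) = (blinfun_apply T ^^ k) x + (blinfun_apply T ^^ k) y" for k x y
    by (rule linear_add[OF bounded_linear.linear[OF bounded_linear_funpow]])
  ultimately show ?thesis
    unfolding bounded_directions_def by (simp add: operator_power_scaleC[OF T])
qed

lemma exists_bounded_directions:
  fixes T :: "'a::complex_banach \<Rightarrow>\<^sub>L 'a"
  assumes T: "T \<in> complex_operators" and E: "complex_vector.subspace E" "infinite_dimensional E"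
    and \<theta>: "strict_mono (\<theta> :: nat \<Rightarrow> nat)"
    and M: "\<And>n x. x \<in> E \<Longrightarrow> norm ((blinfun_apply T ^^ \<theta> n) x) \<le> M * norm x"
  obtains C A V where "bounded_directions T C A V"
proof (cases "\<exists>\<mu>. cmod \<mu> = 1 \<and> approximate_eigenvalue_off_finite_codim T \<mu>")
  case True
  then show thesis using bounded_directions_approximate_eigenvalue[OF T] that by blast
next
  case False
  then obtain \<Phi> c where "finite \<Phi>" "\<And>\<phi>. \<phi> \<in> \<Phi> \<Longrightarrow> clinear_functional \<phi>" "0 < c"
    "\<And>\<mu> x. cmod \<mu> = 1 \<Longrightarrow> x \<in> common_kernel \<Phi> \<Longrightarrow> c * norm x \<le> norm (blinfun_apply T x - \<mu> *\<^sub>C x)"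
    using uniformly_bounded_below_on_circle[OF _ T] by metis
  then have "bounded_directions T ((M + 1) / c) (\<lambda>k. blinfun_apply T ^^ k)
    (\<lambda>k. E \<inter> common_kernel ((\<lambda>(\<phi>, i). \<phi> \<circ> (blinfun_apply T ^^ i)) ` (\<Phi> \<times> {..<\<theta> (Suc k)})))"
    by (intro bounded_directions_bounded_below T E \<theta> M) auto
  then show thesis by (rule that)
qed

text \<open>
The quotients in \<open>onorm_on\<close> are bounded because \<open>T ^^ n\<close> is, so their supremum is an upper bound.
\<close>

lemma onorm_on_bound:
  assumes "x \<in> E" "onorm_on E (blinfun_apply T ^^ n) \<le> M"
  shows "norm ((blinfun_apply T ^^ n) x) \<le> M * norm x"
proof (cases "x = 0")
  case True
  then show ?thesis by (simp add: linear_0[OF bounded_linear.linear[OF bounded_linear_funpow]])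
next
  case False
  obtain K where K: "\<And>y. norm ((blinfun_apply T ^^ n) y) \<le> norm y * K" "0 \<le> K"
    using bounded_linear.nonneg_bounded[OF bounded_linear_funpow] by blast
  have "norm ((blinfun_apply T ^^ n) y) / norm y \<le> K" for y
    using K by (cases "y = 0") (auto simp: field_simps)
  then have "bdd_above ((\<lambda>y. norm ((blinfun_apply T ^^ n) y) / norm y) ` E)" by (intro bdd_aboveI2)
  then have "norm ((blinfun_apply T ^^ n) x) / norm x \<le> onorm_on E (blinfun_apply T ^^ n)"
    unfolding onorm_on_def by (rule cSUP_upper[OF assms(1)])
  also note assms(2)
  finally show ?thesis using False by (simp add: divide_le_eq)
qed

section \<open>Basic sequences\<close>

lemma bounded_linear_scaleC_left: "bounded_linear (\<lambda>c. c *\<^sub>C (v :: 'a::complex_banach))"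
proof (rule bounded_linear_intro[of _ "norm v"])
  show "(r *\<^sub>R c) *\<^sub>C v = r *\<^sub>R c *\<^sub>C v" for r c
    unfolding scaleR_conv_of_real scaleR_scaleC[of r "c *\<^sub>C v"] by (simp only: scaleC_scaleC)
qed (auto simp: scaleC_add_left norm_scaleC)

lemma bounded_linear_scaleC_right: "bounded_linear (\<lambda>x :: 'a::complex_banach. c *\<^sub>C x)"
proof (rule bounded_linear_intro[of _ "cmod c"])
  show "c *\<^sub>C r *\<^sub>R x = r *\<^sub>R c *\<^sub>C x" for r and x :: 'a
    unfolding scaleR_scaleC by (simp only: scaleC_scaleC mult.commute)
qed (auto simp: scaleC_add_right norm_scaleC)

lemma compact_combinations:
  fixes e :: "nat \<Rightarrow> 'a::complex_banach"
  shows "compact {\<Sum>i<n. a i *\<^sub>C e i | a. \<forall>i<n. cmod (a i) \<le> R}" (is "compact (?S n)")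
proof (induction n)
  case 0
  have "?S 0 = {0}" by auto
  then show ?case by simp
next
  case (Suc n)
  let ?K = "(\<lambda>c. c *\<^sub>C e n) ` cball 0 R"
  have "?S (Suc n) = {x + y | x y. x \<in> ?S n \<and> y \<in> ?K}"
  proof (intro equalityI subsetI)
    fix z assume "z \<in> ?S (Suc n)"
    then obtain a where a: "z = (\<Sum>i<Suc n. a i *\<^sub>C e i)" "\<forall>i<Suc n. cmod (a i) \<le> R" by blast
    then have "(\<Sum>i<n. a i *\<^sub>C e i) \<in> ?S n" "a n *\<^sub>C e n \<in> ?K" by auto
    moreover have "z = (\<Sum>i<n. a i *\<^sub>C e i) + a n *\<^sub>C e n" using a(1) by simp
    ultimately show "z \<in> {x + y | x y. x \<in> ?S n \<and> y \<in> ?K}" by blast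
  next
    fix z assume "z \<in> {x + y | x y. x \<in> ?S n \<and> y \<in> ?K}"
    then obtain a c where a: "z = (\<Sum>i<n. a i *\<^sub>C e i) + c *\<^sub>C e n" "\<forall>i<n. cmod (a i) \<le> R" "cmod c \<le> R"
      by auto
    have "z = (\<Sum>i<Suc n. (a(n := c)) i *\<^sub>C e i)" using a(1) by simp
    moreover have "\<forall>i<Suc n. cmod ((a(n := c)) i) \<le> R" using a(2,3) by simp
    ultimately show "z \<in> ?S (Suc n)" by blast
  qed
  moreover have "compact ?K"
    by (intro compact_continuous_image bounded_linear.continuous_on[OF bounded_linear_scaleC_left]) auto
  ultimately show ?case using compact_sums[OF Suc.IH] by simp
qed

text \<open>
Mazur's step: functionals norming a finite net of \<open>S\<close> show that adding a vector of their common kernel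
cannot shorten the elements of \<open>S\<close> by more than \<open>\<delta>\<close>.
\<close>

lemma compact_norming_functionals:
  fixes S :: "'a::complex_banach set"
  assumes S: "compact S" and \<delta>: "0 < \<delta>"
  obtains \<Phi> where "finite \<Phi>" "\<And>\<phi>. \<phi> \<in> \<Phi> \<Longrightarrow> clinear_functional \<phi>"
    "\<And>f g. f \<in> S \<Longrightarrow> g \<in> common_kernel \<Phi> \<Longrightarrow> norm f - \<delta> \<le> norm (f + g)"
proof -
  obtain Z where Z: "finite Z" "S \<subseteq> (\<Union>z\<in>Z. ball z (\<delta> / 2))"
    using seq_compact_imp_totally_bounded[of S] S \<delta> compact_imp_seq_compact half_gt_zero by metis
  have "\<exists>\<phi>. clinear_functional \<phi> \<and> (\<forall>x. cmod (\<phi> x) \<le> norm x) \<and> \<phi> z = norm z" for z :: 'a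
    using norming_functional[of z] by metis
  then obtain N where N: "\<And>z. clinear_functional (N z)" "\<And>z x. cmod (N z x) \<le> norm x"
    "\<And>z :: 'a. N z z = norm z" by metis
  show thesis
  proof (rule that[of "N ` Z"])
    fix f g assume f: "f \<in> S" and g: "g \<in> common_kernel (N ` Z)"
    obtain z where z: "z \<in> Z" "f \<in> ball z (\<delta> / 2)" using Z(2) f by blast
    have zf: "norm (z - f) \<le> \<delta> / 2" using z(2) by (simp add: dist_norm)
    have "N z g = 0" using g z(1) unfolding common_kernel_def by blast
    then have "N z (z + g) = norm z" using N(1)[of z] N(3)[of z] unfolding clinear_functional_def by simp
    then have "norm z \<le> norm (z + g)" using N(2)[of z "z + g"] by simp
    also have "z + g = (f + g) + (z - f)" by simp
    also have "norm \<dots> \<le> norm (f + g) + \<delta> / 2" using norm_triangle_ineq[of "f + g" "z - f"] zf by simp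
    finally show "norm f - \<delta> \<le> norm (f + g)"
      using norm_triangle_ineq2[of f z] zf by (simp add: norm_minus_commute)
  qed (use Z(1) N(1) in auto)
qed

lemma sum_half_powers: "(\<Sum>i<n. (1/2::real) ^ (i + p)) \<le> 2 * (1/2) ^ p"
proof -
  have "(\<Sum>i<n. (1/2::real) ^ (i + p)) = 2 * (1/2) ^ p - 2 * (1/2) ^ (n + p)"
    by (induction n) (auto simp: power_add)
  moreover have "0 \<le> (1/2::real) ^ (n + p)" by simp
  ultimately show ?thesis by linarith
qed

lemma sum_half_powers_subset:
  assumes "finite I"
  shows "(\<Sum>i\<in>I. (1/2::real) ^ (i + p)) \<le> 2 * (1/2) ^ p"
proof -
  obtain n where "I \<subseteq> {..<n}" using assms finite_nat_iff_bounded by blast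
  then have "(\<Sum>i\<in>I. (1/2::real) ^ (i + p)) \<le> (\<Sum>i<n. (1/2::real) ^ (i + p))"
    by (intro sum_mono2) auto
  also note sum_half_powers
  finally show ?thesis .
qed

text \<open>
The hypothesis only concerns coefficients in a bounded box, where compactness is available. It is enough:
if the coefficient bound holds up to \<open>n\<close>, combinations of norm one lie in the box, and then by homogeneity
\<open>(1 - (1/2) ^ (n + 2)) \<parallel>S\<^sub>n\<parallel> \<le> \<parallel>S\<^bsub>n+1\<^esub>\<parallel>\<close>. The product of these factors is at least \<open>1/2\<close>, which yields the
constants \<open>2\<close> for the projections and \<open>4\<close> for the coefficients of the next stage.
\<close>

lemma basic_sequence:
  fixes e :: "nat \<Rightarrow> 'a::complex_banach"
  assumes unit: "\<And>n. norm (e n) = 1"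
    and step: "\<And>n a. (\<And>i. i < n \<Longrightarrow> cmod (a i) \<le> 4) \<Longrightarrow>
      norm (\<Sum>i<n. a i *\<^sub>C e i) - (1/2) ^ (n + 2) \<le> norm (\<Sum>i<Suc n. a i *\<^sub>C e i)"
  shows basic_sequence_projection: "n \<le> m \<Longrightarrow> norm (\<Sum>i<n. a i *\<^sub>C e i) \<le> 2 * norm (\<Sum>i<m. a i *\<^sub>C e i)"
    and basic_sequence_coefficient: "j < m \<Longrightarrow> cmod (a j) \<le> 4 * norm (\<Sum>i<m. a i *\<^sub>C e i)"
proof -
  define \<delta> where "\<delta> n = (1/2::real) ^ (n + 2)" for n :: nat
  define S where "S a n = (\<Sum>i<n. a i *\<^sub>C e i)" for a n
  have \<delta>: "0 \<le> \<delta> n" "\<delta> n \<le> 1" for n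
    unfolding \<delta>_def by (rule zero_le_power, simp, rule power_le_one, simp_all)
  have scale: "S (\<lambda>i. t * a i) n = t *\<^sub>C S a n" for t a n
    by (simp add: S_def complex_vector.scale_sum_right)
  have mono: "(1 - \<delta> n) * norm (S a n) \<le> norm (S a (Suc n))"
    if coeff: "\<And>a j. j < n \<Longrightarrow> cmod (a j) \<le> 4 * norm (S a n)" for n a
  proof (cases "S a n = 0")
    case False
    define t where "t = complex_of_real (1 / norm (S a n))"
    have t: "cmod t = 1 / norm (S a n)" by (simp add: t_def norm_divide)
    have one: "norm (S (\<lambda>i. t * a i) n) = 1" using False by (simp add: scale norm_scaleC t)
    have "norm (S (\<lambda>i. t * a i) n) - \<delta> n \<le> norm (S (\<lambda>i. t * a i) (Suc n))"
      using coeff[of _ "\<lambda>i. t * a i"] one unfolding S_def \<delta>_def by (intro step) simp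
    then have "1 - \<delta> n \<le> norm (S a (Suc n)) / norm (S a n)"
      using one by (simp add: scale norm_scaleC t)
    then show ?thesis using False by (simp add: field_simps)
  qed simp
  have proj: "norm (S a j) \<le> 2 * norm (S a n)"
    if jn: "j \<le> n" and coeff: "\<And>m a j. m < n \<Longrightarrow> j < m \<Longrightarrow> cmod (a j) \<le> 4 * norm (S a m)" for j n a
  proof -
    have "(\<Prod>i=j..<n. 1 - \<delta> i) * norm (S a j) \<le> norm (S a n)" using jn coeff
    proof (induction n rule: dec_induct)
      case (step n)
      have "(\<Prod>i=j..<Suc n. 1 - \<delta> i) * norm (S a j) = (1 - \<delta> n) * ((\<Prod>i=j..<n. 1 - \<delta> i) * norm (S a j))"
        using step.hyps by (simp add: prod.atLeastLessThan_Suc)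
      also have "\<dots> \<le> (1 - \<delta> n) * norm (S a n)"
        using step.IH step.prems \<delta>(2)[of n] by (intro mult_left_mono) auto
      also have "\<dots> \<le> norm (S a (Suc n))" by (intro mono step.prems) auto
      finally show ?case .
    qed simp
    moreover have "1/2 \<le> (\<Prod>i=j..<n. 1 - \<delta> i)"
    proof -
      have "1 - (\<Sum>i=j..<n. \<delta> i) \<le> (\<Prod>i=j..<n. 1 - \<delta> i)"
        using \<delta> by (intro Weierstrass_prod_ineq) auto
      moreover have "(\<Sum>i=j..<n. \<delta> i) \<le> 1/2"
        using sum_half_powers_subset[of "{j..<n}" 2] by (simp add: \<delta>_def power2_eq_square)
      ultimately show ?thesis by simp
    qed
    then have "1/2 * norm (S a j) \<le> (\<Prod>i=j..<n. 1 - \<delta> i) * norm (S a j)" by (rule mult_right_mono) simp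
    ultimately show ?thesis by simp
  qed
  have coeff: "j < n \<Longrightarrow> cmod (a j) \<le> 4 * norm (S a n)" for n a j
  proof (induction n arbitrary: a j rule: less_induct)
    case (less n)
    have "a j *\<^sub>C e j = S a (Suc j) - S a j" by (simp add: S_def)
    then have "cmod (a j) \<le> norm (S a (Suc j)) + norm (S a j)"
      using norm_triangle_ineq4[of "S a (Suc j)" "S a j"] unit[of j] norm_scaleC[of "a j" "e j"] by simp
    also have "\<dots> \<le> 2 * norm (S a n) + 2 * norm (S a n)"
      using less by (intro add_mono proj) auto
    finally show ?case by simp
  qed
  show "n \<le> m \<Longrightarrow> norm (\<Sum>i<n. a i *\<^sub>C e i) \<le> 2 * norm (\<Sum>i<m. a i *\<^sub>C e i)"
    using proj[of n m a] coeff unfolding S_def by blast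
  show "j < m \<Longrightarrow> cmod (a j) \<le> 4 * norm (\<Sum>i<m. a i *\<^sub>C e i)"
    using coeff[of j m a] unfolding S_def by blast
qed

text \<open>Dependent choice in which each term may depend on all its predecessors.\<close>

lemma choice_with_history:
  assumes "\<And>xs :: 'b list. \<exists>y. P xs y"
  obtains s :: "nat \<Rightarrow> 'b" where "\<And>n. P (map s [0..<n]) (s n)"
proof -
  define f where "f xs = (SOME y. P xs y)" for xs
  define hist where "hist = rec_nat [] (\<lambda>_ xs. xs @ [f xs])"
  define s where "s n = f (hist n)" for n
  have "map s [0..<n] = hist n" for n by (induction n) (auto simp: hist_def s_def)
  moreover have "P xs (f xs)" for xs unfolding f_def by (rule someI_ex[OF assms])
  ultimately show thesis by (intro that[of s]) (simp add: s_def)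
qed

section \<open>Interlacing a basic sequence with recurrence times\<close>

text \<open>
The outcome of the recursive construction: a basic sequence \<open>e\<close>, its perturbation \<open>f\<close> and the times \<open>\<kappa>\<close>.
The errors \<open>(1/2) ^ (n + 4)\<close> have sum \<open>1/8\<close>, whereas coefficients with respect to \<open>e\<close> are bounded by \<open>4\<close>
times the norm; so \<open>f\<close> stays equivalent to \<open>e\<close>.
\<close>

locale interlaced =
  fixes T :: "'a::complex_banach \<Rightarrow>\<^sub>L 'a" and H :: "nat \<Rightarrow> 'a \<Rightarrow>\<^sub>L 'a"
    and C :: real and A :: "nat \<Rightarrow> 'a \<Rightarrow> 'a" and V :: "nat \<Rightarrow> 'a set"
    and e f :: "nat \<Rightarrow> 'a" and \<kappa> :: "nat \<Rightarrow> nat"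
  assumes T: "T \<in> complex_operators" and H: "H n \<in> complex_operators"
    and dir: "bounded_directions T C A V"
    and unit: "norm (e n) = 1"
    and basic: "(\<And>i. i < n \<Longrightarrow> cmod (a i) \<le> 4) \<Longrightarrow>
      norm (\<Sum>i<n. a i *\<^sub>C e i) - (1/2) ^ (n + 2) \<le> norm (\<Sum>i<Suc n. a i *\<^sub>C e i)"
    and e_V: "i < n \<Longrightarrow> e n \<in> V (\<kappa> i)"
    and e_A: "i < n \<Longrightarrow> norm ((blinfun_apply T ^^ \<kappa> i) (e n) - A (\<kappa> i) (e n)) \<le> (1/2) ^ (n + 4)"
    and f_e: "norm (f n - e n) \<le> (1/2) ^ (n + 4)"
    and T_f_e: "i < n \<Longrightarrow> norm ((blinfun_apply T ^^ \<kappa> i) (f n - e n)) \<le> (1/2) ^ (n + 4)"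
    and \<kappa>: "n < \<kappa> n"
    and T_H: "i \<le> n \<Longrightarrow> norm ((blinfun_apply T ^^ \<kappa> n) (f i) - blinfun_apply (H n) (f i)) \<le> (1/2) ^ (n + 4)"

lemma interlaced_sequences:
  fixes T :: "'a::complex_banach \<Rightarrow>\<^sub>L 'a" and H :: "nat \<Rightarrow> 'a \<Rightarrow>\<^sub>L 'a"
    and d :: "nat \<Rightarrow> 'a"
  assumes T: "T \<in> complex_operators" and H: "\<And>n. H n \<in> complex_operators"
    and dir: "bounded_directions T C A V"
    and dense: "closure (range d) = UNIV"
    and rec: "\<forall>n N m. \<forall>\<epsilon>>0.
      \<exists>k>m. \<forall>i<N. norm ((blinfun_apply T ^^ k) (d i) - blinfun_apply (H n) (d i)) < \<epsilon>"
  obtains e f \<kappa> where "interlaced T H C A V e f \<kappa>"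
proof -
  define \<epsilon> where "\<epsilon> n = (1/2::real) ^ (n + 4)" for n :: nat
  have \<epsilon>: "0 < \<epsilon> n" for n by (simp add: \<epsilon>_def)
  \<comment> \<open>A stage is a triple \<open>(e, j, k)\<close>: the vector \<open>e\<close>, the index \<open>j\<close> of the vector \<open>d j\<close> that approximates it,
    and the time \<open>k\<close>; the list \<open>xs\<close> holds the previous stages.\<close>
  define good_e where "good_e xs e \<longleftrightarrow> norm e = 1 \<and>
      (\<forall>a c. (\<forall>i<length xs. cmod (a i) \<le> 4) \<longrightarrow>
        norm (\<Sum>i<length xs. a i *\<^sub>C fst (xs ! i)) - (1/2) ^ (length xs + 2)
          \<le> norm ((\<Sum>i<length xs. a i *\<^sub>C fst (xs ! i)) + c *\<^sub>C e)) \<and>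
      (\<forall>i<length xs. e \<in> V (snd (snd (xs ! i))) \<and>
        norm ((blinfun_apply T ^^ snd (snd (xs ! i))) e - A (snd (snd (xs ! i))) e) \<le> \<epsilon> (length xs))"
    for xs :: "('a \<times> nat \<times> nat) list" and e
  define good_j where "good_j xs e j \<longleftrightarrow> norm (d j - e) \<le> \<epsilon> (length xs) \<and>
      (\<forall>i<length xs. norm ((blinfun_apply T ^^ snd (snd (xs ! i))) (d j - e)) \<le> \<epsilon> (length xs))"
    for xs :: "('a \<times> nat \<times> nat) list" and e j
  define good_k where "good_k xs j k \<longleftrightarrow> length xs < k \<and>
      (\<forall>l\<in>insert j ((fst \<circ> snd) ` set xs).
        norm ((blinfun_apply T ^^ k) (d l) - blinfun_apply (H (length xs)) (d l)) \<le> \<epsilon> (length xs))"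
    for xs :: "('a \<times> nat \<times> nat) list" and j k
  have ex_e: "\<exists>e. good_e xs e" for xs
  proof -
    let ?n = "length xs"
    let ?S = "{\<Sum>i<?n. a i *\<^sub>C fst (xs ! i) | a. \<forall>i<?n. cmod (a i) \<le> 4}"
    have "0 < (1/2::real) ^ (?n + 2)" by simp
    from compact_norming_functionals[OF compact_combinations[where n = ?n and e = "\<lambda>i. fst (xs ! i)" and R = 4] this]
    obtain \<Phi> where \<Phi>: "finite \<Phi>" "\<And>\<phi>. \<phi> \<in> \<Phi> \<Longrightarrow> clinear_functional \<phi>"
      "\<And>f g. f \<in> ?S \<Longrightarrow> g \<in> common_kernel \<Phi> \<Longrightarrow> norm f - (1/2) ^ (?n + 2) \<le> norm (f + g)"
      by blast
    let ?K = "(snd \<circ> snd) ` set xs"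
    have "finite ?K" by simp
    from bounded_directions_vector[OF dir \<Phi>(1) \<Phi>(2) this \<epsilon>[of ?n]] obtain e where e: "e \<in> common_kernel \<Phi>" "norm e = 1"
      "\<And>k. k \<in> ?K \<Longrightarrow> e \<in> V k \<and> norm ((blinfun_apply T ^^ k) e - A k e) \<le> \<epsilon> ?n" by blast
    have "c *\<^sub>C e \<in> common_kernel \<Phi>" for c
      by (rule complex_vector.subspace_scale[OF subspace_common_kernel[OF \<Phi>(2)] e(1)])
    then have "norm (\<Sum>i<?n. a i *\<^sub>C fst (xs ! i)) - (1/2) ^ (?n + 2)
        \<le> norm ((\<Sum>i<?n. a i *\<^sub>C fst (xs ! i)) + c *\<^sub>C e)" if "\<forall>i<?n. cmod (a i) \<le> 4" for a c
      using that by (intro \<Phi>(3)) auto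
    moreover have "snd (snd (xs ! i)) \<in> ?K" if "i < ?n" for i using that by force
    ultimately show ?thesis unfolding good_e_def using e(2,3) by blast
  qed
  have ex_j: "\<exists>j. good_j xs e j" for xs e
  proof -
    let ?n = "length xs"
    let ?U = "{y. norm (y - e) < \<epsilon> ?n} \<inter>
      (\<Inter>i\<in>{..<?n}. {y. norm ((blinfun_apply T ^^ snd (snd (xs ! i))) (y - e)) < \<epsilon> ?n})"
    have "open ?U"
      by (intro open_Int open_INT finite_lessThan ballI open_Collect_less continuous_intros
          bounded_linear.continuous_on[OF bounded_linear_funpow])
    moreover have "(blinfun_apply T ^^ k) 0 = 0" for k
      by (rule linear_0[OF bounded_linear.linear[OF bounded_linear_funpow]])
    then have "e \<in> ?U" using \<epsilon> by simp
    ultimately have "range d \<inter> ?U \<noteq> {}"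
      using open_Int_closure_eq_empty[of ?U "range d"] dense by blast
    then obtain j where "d j \<in> ?U" by blast
    then have "good_j xs e j" by (auto simp: good_j_def intro: less_imp_le)
    then show ?thesis by blast
  qed
  have ex_k: "\<exists>k. good_k xs j k" for xs j
  proof -
    obtain N where N: "insert j ((fst \<circ> snd) ` set xs) \<subseteq> {..<N}"
      using finite_nat_iff_bounded[of "insert j ((fst \<circ> snd) ` set xs)"] by auto
    obtain k where "k > length xs"
      "\<forall>i<N. norm ((blinfun_apply T ^^ k) (d i) - blinfun_apply (H (length xs)) (d i)) < \<epsilon> (length xs)"
      using rec \<epsilon> by blast
    then have "good_k xs j k" unfolding good_k_def using N by (simp add: less_imp_le subset_iff)
    then show ?thesis by blast
  qed
  define P where "P xs y \<longleftrightarrow> good_e xs (fst y) \<and> good_j xs (fst y) (fst (snd y)) \<and>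
      good_k xs (fst (snd y)) (snd (snd y))" for xs y
  have "\<exists>y. P xs y" for xs
  proof -
    obtain e where e: "good_e xs e" using ex_e by blast
    obtain j where j: "good_j xs e j" using ex_j by blast
    obtain k where k: "good_k xs j k" using ex_k by blast
    show ?thesis by (rule exI[of _ "(e, j, k)"]) (simp add: P_def e j k)
  qed
  from choice_with_history[of P, OF this] obtain s where s: "\<And>n. P (map s [0..<n]) (s n)" by blast
  define e where "e n = fst (s n)" for n
  define f where "f n = d (fst (snd (s n)))" for n
  define \<kappa> where "\<kappa> n = snd (snd (s n))" for n
  have E: "good_e (map s [0..<n]) (e n)" and J: "good_j (map s [0..<n]) (e n) (fst (snd (s n)))"
    and K: "good_k (map s [0..<n]) (fst (snd (s n))) (\<kappa> n)" for n
    using s[of n] by (auto simp: P_def e_def \<kappa>_def)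
  have "interlaced T H C A V e f \<kappa>"
  proof (rule interlaced.intro)
    show "norm (e n) = 1" for n using E[of n] by (simp add: good_e_def)
    show "norm (\<Sum>i<n. a i *\<^sub>C e i) - (1/2) ^ (n + 2) \<le> norm (\<Sum>i<Suc n. a i *\<^sub>C e i)"
      if "\<And>i. i < n \<Longrightarrow> cmod (a i) \<le> 4" for n a
    proof -
      have "(\<Sum>i<n. a i *\<^sub>C fst (map s [0..<n] ! i)) = (\<Sum>i<n. a i *\<^sub>C e i)"
        by (intro sum.cong) (auto simp: e_def)
      moreover have "\<forall>c. norm (\<Sum>i<n. a i *\<^sub>C fst (map s [0..<n] ! i)) - (1/2) ^ (n + 2)
          \<le> norm ((\<Sum>i<n. a i *\<^sub>C fst (map s [0..<n] ! i)) + c *\<^sub>C e n)"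
        using E[of n] that unfolding good_e_def by simp
      ultimately have "norm (\<Sum>i<n. a i *\<^sub>C e i) - (1/2) ^ (n + 2) \<le> norm ((\<Sum>i<n. a i *\<^sub>C e i) + a n *\<^sub>C e n)"
        by (simp only:)
      then show ?thesis by (simp only: sum.lessThan_Suc)
    qed
    show "e n \<in> V (\<kappa> i)" "norm ((blinfun_apply T ^^ \<kappa> i) (e n) - A (\<kappa> i) (e n)) \<le> (1/2) ^ (n + 4)"
      if "i < n" for i n
      using E[of n] that unfolding good_e_def \<kappa>_def \<epsilon>_def by auto
    show "norm (f n - e n) \<le> (1/2) ^ (n + 4)" for n using J[of n] by (simp add: good_j_def f_def \<epsilon>_def)
    show "norm ((blinfun_apply T ^^ \<kappa> i) (f n - e n)) \<le> (1/2) ^ (n + 4)" if "i < n" for i n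
      using J[of n] that unfolding good_j_def f_def \<kappa>_def \<epsilon>_def by auto
    show "n < \<kappa> n" for n using K[of n] by (simp add: good_k_def)
    show "norm ((blinfun_apply T ^^ \<kappa> n) (f i) - blinfun_apply (H n) (f i)) \<le> (1/2) ^ (n + 4)" if "i \<le> n" for i n
    proof -
      have "fst (snd (s i)) \<in> insert (fst (snd (s n))) ((fst \<circ> snd) ` set (map s [0..<n]))"
        using that by (cases "i = n") auto
      moreover have "\<forall>l\<in>insert (fst (snd (s n))) ((fst \<circ> snd) ` set (map s [0..<n])).
          norm ((blinfun_apply T ^^ \<kappa> n) (d l) - blinfun_apply (H n) (d l)) \<le> (1/2) ^ (n + 4)"
        using K[of n] unfolding good_k_def \<epsilon>_def by simp
      ultimately show ?thesis unfolding f_def by (rule bspec[rotated])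
    qed
  qed (fact T H dir)+
  then show thesis by (rule that)
qed

section \<open>Recurrence on a closed subspace\<close>

lemma R_setI:
  assumes "\<And>\<delta> m. 0 < \<delta> \<Longrightarrow> \<exists>k>m. norm ((blinfun_apply T ^^ k) x - blinfun_apply h x) < \<delta>"
  shows "x \<in> R_set T h"
proof -
  have "\<exists>\<omega>. \<forall>n. (0 < \<omega> n \<and> norm ((blinfun_apply T ^^ \<omega> n) x - blinfun_apply h x) < 1 / real (Suc n)) \<and>
      \<omega> n < \<omega> (Suc n)"
  proof (rule dependent_nat_choice)
    show "\<exists>k>0. norm ((blinfun_apply T ^^ k) x - blinfun_apply h x) < 1 / real (Suc 0)"
      by (rule assms) simp
    fix m n :: nat
    obtain k where "k > m" "norm ((blinfun_apply T ^^ k) x - blinfun_apply h x) < 1 / real (Suc (Suc n))"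
      using assms[of "1 / real (Suc (Suc n))" m] by auto
    then show "\<exists>k. (0 < k \<and> norm ((blinfun_apply T ^^ k) x - blinfun_apply h x) < 1 / real (Suc (Suc n))) \<and> m < k"
      by (intro exI[of _ k]) simp
  qed
  then obtain \<omega> where \<omega>: "\<And>n. 0 < \<omega> n" "\<And>n. \<omega> n < \<omega> (Suc n)"
    "\<And>n. norm ((blinfun_apply T ^^ \<omega> n) x - blinfun_apply h x) < 1 / real (Suc n)" by blast
  have "(\<lambda>n. (blinfun_apply T ^^ \<omega> n) x - blinfun_apply h x) \<longlonglongrightarrow> 0"
    by (rule LIMSEQ_norm_0[OF \<omega>(3)])
  then have "(\<lambda>n. (blinfun_apply T ^^ \<omega> n) x) \<longlonglongrightarrow> blinfun_apply h x" by (rule LIM_zero_cancel)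
  then show ?thesis
    using \<omega>(1,2) unfolding R_set_def pos_strict_seq_def by (auto simp: strict_mono_Suc_iff)
qed

lemma subspace_closure:
  assumes S: "complex_vector.subspace (S :: 'a::complex_banach set)"
  shows "complex_vector.subspace (closure S)"
proof (rule complex_vector.subspaceI)
  show "0 \<in> closure S" using complex_vector.subspace_0[OF S] closure_subset by blast
next
  fix x y assume "x \<in> closure S" "y \<in> closure S"
  then obtain X Y where "\<And>n. X n \<in> S" "X \<longlonglongrightarrow> x" "\<And>n. Y n \<in> S" "Y \<longlonglongrightarrow> y"
    unfolding closure_sequential by metis
  then show "x + y \<in> closure S"
    unfolding closure_sequential using complex_vector.subspace_add[OF S]
    by (intro exI[of _ "\<lambda>n. X n + Y n"]) (auto intro: tendsto_add)
next
  fix c x assume "x \<in> closure S"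
  then obtain X where "\<And>n. X n \<in> S" "X \<longlonglongrightarrow> x" unfolding closure_sequential by metis
  then show "c *\<^sub>C x \<in> closure S"
    unfolding closure_sequential using complex_vector.subspace_scale[OF S]
    by (intro exI[of _ "\<lambda>n. c *\<^sub>C X n"]) (auto intro: bounded_linear.tendsto[OF bounded_linear_scaleC_right])
qed

lemma finite_combinations_pad:
  assumes "(N :: nat) \<le> M"
  shows "(\<Sum>i<N. a i *\<^sub>C f i) = (\<Sum>i<M. (if i < N then a i else 0) *\<^sub>C (f i :: 'a::complex_banach))"
proof -
  have "(\<Sum>i<M. (if i < N then a i else 0) *\<^sub>C f i) = (\<Sum>i<N. (if i < N then a i else 0) *\<^sub>C f i)"
    using assms by (intro sum.mono_neutral_right) auto
  also have "\<dots> = (\<Sum>i<N. a i *\<^sub>C f i)" by (intro sum.cong) auto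
  finally show ?thesis ..
qed

lemma subspace_finite_combinations:
  "complex_vector.subspace {\<Sum>i<N. a i *\<^sub>C (f i :: 'a::complex_banach) | a (N :: nat). True}" (is "complex_vector.subspace ?S")
proof (rule complex_vector.subspaceI)
  show "0 \<in> ?S" by (intro CollectI exI[of _ "\<lambda>_. 0"] exI[of _ 0]) simp
next
  fix x y assume "x \<in> ?S" "y \<in> ?S"
  then obtain a N b M where xy: "x = (\<Sum>i<N. a i *\<^sub>C f i)" "y = (\<Sum>i<M. b i *\<^sub>C f i)" by blast
  have "x + y = (\<Sum>i<N+M. (if i < N then a i else 0) *\<^sub>C f i) + (\<Sum>i<N+M. (if i < M then b i else 0) *\<^sub>C f i)"
    unfolding xy by (intro arg_cong2[of _ _ _ _ plus] finite_combinations_pad) auto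
  also have "\<dots> = (\<Sum>i<N+M. ((if i < N then a i else 0) + (if i < M then b i else 0)) *\<^sub>C f i)"
    by (simp only: sum.distrib scaleC_add_left)
  finally have "x + y = (\<Sum>i<N+M. ((if i < N then a i else 0) + (if i < M then b i else 0)) *\<^sub>C f i)" .
  then show "x + y \<in> ?S" by (intro CollectI exI conjI TrueI)
next
  fix c x assume "x \<in> ?S"
  then obtain a N where "x = (\<Sum>i<N. a i *\<^sub>C f i)" by blast
  then have "c *\<^sub>C x = (\<Sum>i<N. (c * a i) *\<^sub>C f i)"
    by (simp add: complex_vector.scale_sum_right)
  then show "c *\<^sub>C x \<in> ?S" by (intro CollectI exI conjI TrueI)
qed

text \<open>
The hypothesis \<open>coeff\<close> states linear independence of the family \<open>f\<close>, in terms of initial segments.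
\<close>

lemma infinite_dimensional_if_coefficients_determined:
  fixes f :: "nat \<Rightarrow> 'a::complex_banach"
  assumes f: "\<And>n. f n \<in> Z"
    and coeff: "\<And>a N j. (\<Sum>i<N. a i *\<^sub>C f i) = 0 \<Longrightarrow> j < N \<Longrightarrow> a j = 0"
  shows "infinite_dimensional Z"
proof -
  have inj: "inj f"
  proof (rule injI, rule ccontr)
    fix i j assume ij: "f i = f j" "i \<noteq> j"
    define N where "N = Suc (max i j)"
    have N: "i < N" "j < N" by (auto simp: N_def)
    define a :: "nat \<Rightarrow> complex" where "a k = (if k = i then 1 else 0) - (if k = j then 1 else 0)" for k
    have "(\<Sum>k<N. a k *\<^sub>C f k) = (\<Sum>k<N. (if k = i then f k else 0)) - (\<Sum>k<N. (if k = j then f k else 0))"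
      unfolding a_def sum_subtractf[symmetric] by (intro sum.cong) auto
    also have "\<dots> = 0" using ij(1) N by simp
    finally have "a i = 0" using coeff N(1) by blast
    then show False using ij(2) by (simp add: a_def)
  qed
  have "complex_vector.independent (range f)"
    unfolding complex_vector.independent_explicit_finite_subsets
  proof (intro allI impI ballI)
    fix S u v assume S: "S \<subseteq> range f" "finite S" and 0: "(\<Sum>v\<in>S. u v *\<^sub>C v) = 0" and v: "v \<in> S"
    obtain I where I: "S = f ` I" using S(1) by (meson subset_imageE)
    then have finI: "finite I" using S(2) inj by (meson finite_imageD inj_on_subset subset_UNIV)
    obtain N where N: "I \<subseteq> {..<N}" using finI finite_nat_iff_bounded by blast
    obtain j where j: "v = f j" "j \<in> I" using v I by blast
    have "(\<Sum>i<N. (if i \<in> I then u (f i) else 0) *\<^sub>C f i) = (\<Sum>i\<in>I. (if i \<in> I then u (f i) else 0) *\<^sub>C f i)"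
      using N by (intro sum.mono_neutral_right) auto
    also have "\<dots> = (\<Sum>i\<in>I. u (f i) *\<^sub>C f i)" by (intro sum.cong) auto
    also have "\<dots> = (\<Sum>v\<in>S. u v *\<^sub>C v)"
      unfolding I by (subst sum.reindex) (use inj in \<open>auto intro: inj_on_subset\<close>)
    finally have "(if j \<in> I then u (f j) else 0) = 0"
      using coeff[where N = N and a = "\<lambda>i. if i \<in> I then u (f i) else 0" and j = j] 0 j(2) N by auto
    then show "u v = 0" using j by simp
  qed
  moreover have "infinite (range f)" using inj by (rule range_inj_infinite)
  ultimately show ?thesis
    using complex_vector.independent_span_bound[of _ "range f"] f unfolding infinite_dimensional_def by blast
qed

text \<open>
Closeness in the strong operator topology is only needed at the single vector \<open>x\<close>.
\<close>

lemma R_sets_of_SOT_dense_subset: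
  assumes "F \<subseteq> strong_operator_topology closure_of G" and h: "h \<in> F"
    and G: "\<And>g \<delta> m. g \<in> G \<Longrightarrow> 0 < \<delta> \<Longrightarrow> \<exists>k>m. norm ((blinfun_apply T ^^ k) x - blinfun_apply g x) < \<delta>"
  shows "x \<in> R_set T h"
proof (rule R_setI)
  fix \<delta> :: real and m :: nat assume \<delta>: "0 < \<delta>"
  let ?U = "{g. blinfun_apply g x \<in> ball (blinfun_apply h x) (\<delta> / 2)}"
  have "openin strong_operator_topology ?U"
    using openin_continuous_map_preimage[OF strong_operator_topology_continuous_evaluation[of x], of "ball (blinfun_apply h x) (\<delta> / 2)"]
    by (simp add: strong_operator_topology_topspace)
  moreover have "h \<in> strong_operator_topology closure_of G" using assms(1) h by blast
  ultimately obtain g where g: "g \<in> G" "g \<in> ?U"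
    using \<delta> unfolding in_closure_of by (metis (no_types, lifting) centre_in_ball half_gt_zero mem_Collect_eq)
  obtain k where k: "k > m" "norm ((blinfun_apply T ^^ k) x - blinfun_apply g x) < \<delta> / 2"
    using G[OF g(1), of "\<delta> / 2" m] \<delta> by auto
  have "norm ((blinfun_apply T ^^ k) x - blinfun_apply h x)
      \<le> norm ((blinfun_apply T ^^ k) x - blinfun_apply g x) + norm (blinfun_apply g x - blinfun_apply h x)"
    by (rule norm_diff_triangle_le[OF order_refl order_refl])
  also have "\<dots> < \<delta>" using k(2) g(2) by (simp add: dist_norm norm_minus_commute)
  finally show "\<exists>k>m. norm ((blinfun_apply T ^^ k) x - blinfun_apply h x) < \<delta>" using k(1) by blast
qed

lemma norm_combination_le:
  fixes g :: "nat \<Rightarrow> 'a::complex_banach"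
  assumes "finite I" "\<And>i. i \<in> I \<Longrightarrow> cmod (a i) \<le> B" "\<And>i. i \<in> I \<Longrightarrow> norm (g i) \<le> (1/2) ^ (i + 4)" "0 \<le> B"
  shows "norm (\<Sum>i\<in>I. a i *\<^sub>C g i) \<le> B / 8"
proof -
  have "norm (\<Sum>i\<in>I. a i *\<^sub>C g i) \<le> (\<Sum>i\<in>I. B * (1/2) ^ (i + 4))"
  proof (rule sum_norm_le)
    fix i assume "i \<in> I"
    then have "cmod (a i) * norm (g i) \<le> B * (1/2) ^ (i + 4)"
      using assms by (intro mult_mono) auto
    then show "norm (a i *\<^sub>C g i) \<le> B * (1/2) ^ (i + 4)" by (simp only: norm_scaleC)
  qed
  also have "\<dots> = B * (\<Sum>i\<in>I. (1/2) ^ (i + 4))" by (simp only: sum_distrib_left)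
  also have "\<dots> \<le> B * (2 * (1/2) ^ 4)"
    by (intro mult_left_mono sum_half_powers_subset assms)
  finally show ?thesis by (simp add: power_divide)
qed

lemma additive_homogeneous_sum:
  assumes add: "\<And>x y. L (x + y) = L x + L (y :: 'a::complex_banach)" and hom: "\<And>c x. L (c *\<^sub>C x) = c *\<^sub>C L x"
  shows "L (\<Sum>i\<in>I. a i *\<^sub>C g i) = (\<Sum>i\<in>I. a i *\<^sub>C (L (g i) :: 'a))"
proof -
  have "L 0 = 0" using hom[of 0 0] by simp
  then show ?thesis by (induction I rule: infinite_finite_induct) (auto simp: add hom)
qed

context interlaced
begin

lemma power_sum: "(blinfun_apply T ^^ k) (\<Sum>i\<in>I. a i *\<^sub>C g i) = (\<Sum>i\<in>I. a i *\<^sub>C (blinfun_apply T ^^ k) (g i))"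
  by (rule additive_homogeneous_sum[OF linear_add[OF bounded_linear.linear[OF bounded_linear_funpow]]
        operator_power_scaleC[OF T]])

lemma H_sum: "blinfun_apply (H n) (\<Sum>i\<in>I. a i *\<^sub>C g i) = (\<Sum>i\<in>I. a i *\<^sub>C blinfun_apply (H n) (g i))"
  using H[of n] unfolding complex_operators_def by (intro additive_homogeneous_sum) (auto simp: blinfun.add_right)

lemma projection_bound:
  assumes "n \<le> m"
  shows "norm (\<Sum>i<n. a i *\<^sub>C e i) \<le> 2 * norm (\<Sum>i<m. a i *\<^sub>C e i)"
proof (rule basic_sequence_projection)
  show "norm (\<Sum>i<n. a i *\<^sub>C e i) - (1/2) ^ (n + 2) \<le> norm (\<Sum>i<Suc n. a i *\<^sub>C e i)"
    if "\<And>i. i < n \<Longrightarrow> cmod (a i) \<le> 4" for n a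
    by (rule basic) (rule that)
qed (fact unit assms)+

lemma coefficient_bound:
  assumes "j < m"
  shows "cmod (a j) \<le> 4 * norm (\<Sum>i<m. a i *\<^sub>C e i)"
proof (rule basic_sequence_coefficient)
  show "norm (\<Sum>i<n. a i *\<^sub>C e i) - (1/2) ^ (n + 2) \<le> norm (\<Sum>i<Suc n. a i *\<^sub>C e i)"
    if "\<And>i. i < n \<Longrightarrow> cmod (a i) \<le> 4" for n a
    by (rule basic) (rule that)
qed (fact unit assms)+

lemma perturbation:
  shows norm_e_le: "norm (\<Sum>i<N. a i *\<^sub>C e i) \<le> 2 * norm (\<Sum>i<N. a i *\<^sub>C f i)"
    and norm_f_le: "norm (\<Sum>i<N. a i *\<^sub>C f i) \<le> 2 * norm (\<Sum>i<N. a i *\<^sub>C e i)"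
    and coeff_le: "j < N \<Longrightarrow> cmod (a j) \<le> 8 * norm (\<Sum>i<N. a i *\<^sub>C f i)"
proof -
  let ?x = "\<Sum>i<N. a i *\<^sub>C f i" and ?y = "\<Sum>i<N. a i *\<^sub>C e i"
  have 4: "cmod (a j) \<le> 4 * norm ?y" if "j < N" for j
    by (rule coefficient_bound[OF that])
  have "?x - ?y = (\<Sum>i<N. a i *\<^sub>C (f i - e i))" by (simp only: complex_vector.scale_right_diff_distrib sum_subtractf)
  also have "norm \<dots> \<le> (4 * norm ?y) / 8"
    using 4 by (intro norm_combination_le f_e) auto
  finally have d: "norm (?x - ?y) \<le> norm ?y / 2" by simp
  show y: "norm ?y \<le> 2 * norm ?x" using d norm_triangle_ineq2[of ?y ?x] by (simp add: norm_minus_commute)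
  show "norm ?x \<le> 2 * norm ?y" using d norm_triangle_ineq2[of ?x ?y] norm_ge_zero[of ?y] by linarith
  show "j < N \<Longrightarrow> cmod (a j) \<le> 8 * norm ?x" using 4[of j] y by simp
qed

text \<open>
The bound depends on \<open>n\<close> only through \<open>norm (H n)\<close>; it is uniform over the infinitely many \<open>n\<close> at which
\<open>H n\<close> is a given operator.
\<close>

lemma power_bound:
  "norm ((blinfun_apply T ^^ \<kappa> n) (\<Sum>i<N. a i *\<^sub>C f i))
    \<le> (3 + 8 * norm (H n) + 6 * \<bar>C\<bar>) * norm (\<Sum>i<N. a i *\<^sub>C f i)"
proof -
  let ?T = "blinfun_apply T ^^ \<kappa> n" and ?h = "blinfun_apply (H n)"
  let ?x = "\<Sum>i<N. a i *\<^sub>C f i" and ?y = "\<Sum>i<N. a i *\<^sub>C e i"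
  \<comment> \<open>The vectors \<open>f i\<close> with \<open>i < m\<close> are chosen before the time \<open>\<kappa> n\<close>, the others after it.\<close>
  define m where "m = min (Suc n) N"
  have I: "{..<N} = {..<m} \<union> {m..<N}" "{..<m} \<inter> {m..<N} = {}" by (auto simp: m_def)
  have mN: "m \<le> N" by (simp add: m_def)
  have late: "n < i" "i < N" if "i \<in> {m..<N}" for i using that by (auto simp: m_def)
  have split: "(\<Sum>i<N. g i) = (\<Sum>i<m. g i) + (\<Sum>i\<in>{m..<N}. g i)" for g :: "nat \<Rightarrow> 'a"
    unfolding I(1) by (rule sum.union_disjoint) (use I(2) in auto)
  have co: "cmod (a i) \<le> 8 * norm ?x" if "i < N" for i using coeff_le[OF that] .
  have p1: "norm (\<Sum>i<m. a i *\<^sub>C (?T (f i) - ?h (f i))) \<le> (8 * norm ?x) / 8"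
  proof (rule norm_combination_le)
    fix i assume "i \<in> {..<m}"
    then have i: "i \<le> n" "i < N" by (auto simp: m_def)
    show "cmod (a i) \<le> 8 * norm ?x" by (rule co[OF i(2)])
    have "(1/2::real) ^ (n + 4) \<le> (1/2) ^ (i + 4)" using i(1) by (intro power_decreasing) auto
    then show "norm (?T (f i) - ?h (f i)) \<le> (1/2) ^ (i + 4)" using T_H[OF i(1)] by linarith
  qed auto
  have p2: "norm (?h (\<Sum>i<m. a i *\<^sub>C f i)) \<le> norm (H n) * (8 * norm ?x)"
  proof -
    have "norm (\<Sum>i<m. a i *\<^sub>C f i) \<le> 2 * norm (\<Sum>i<m. a i *\<^sub>C e i)" by (rule norm_f_le)
    also have "\<dots> \<le> 2 * (2 * norm ?y)"
      using projection_bound[OF mN, of a] by simp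
    also have "\<dots> \<le> 8 * norm ?x" using norm_e_le[of a N] by simp
    finally show ?thesis by (rule order_trans[OF norm_blinfun mult_left_mono]) simp
  qed
  have p3: "norm (\<Sum>i\<in>{m..<N}. a i *\<^sub>C ?T (f i - e i)) \<le> (8 * norm ?x) / 8"
    using late T_f_e co by (intro norm_combination_le) auto
  have p4: "norm (\<Sum>i\<in>{m..<N}. a i *\<^sub>C (?T (e i) - A (\<kappa> n) (e i))) \<le> (8 * norm ?x) / 8"
    using late e_A co by (intro norm_combination_le) auto
  have p5: "norm (A (\<kappa> n) (\<Sum>i\<in>{m..<N}. a i *\<^sub>C e i)) \<le> \<bar>C\<bar> * (6 * norm ?x)"
  proof -
    have "(\<Sum>i\<in>{m..<N}. a i *\<^sub>C e i) = ?y - (\<Sum>i<m. a i *\<^sub>C e i)" by (subst split) simp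
    also have "norm \<dots> \<le> norm ?y + 2 * norm ?y"
      using norm_triangle_ineq4[of ?y "\<Sum>i<m. a i *\<^sub>C e i"] projection_bound[OF mN, of a] by linarith
    also have "\<dots> \<le> 6 * norm ?x" using norm_e_le[of a N] by simp
    finally have tail: "norm (\<Sum>i\<in>{m..<N}. a i *\<^sub>C e i) \<le> 6 * norm ?x" .
    note V = bounded_directionsD(1)[OF dir, of "\<kappa> n"]
    have "(\<Sum>i\<in>{m..<N}. a i *\<^sub>C e i) \<in> V (\<kappa> n)"
      using e_V late by (intro complex_vector.subspace_sum[OF V] complex_vector.subspace_scale[OF V]) auto
    then have "norm (A (\<kappa> n) (\<Sum>i\<in>{m..<N}. a i *\<^sub>C e i)) \<le> C * norm (\<Sum>i\<in>{m..<N}. a i *\<^sub>C e i)"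
      by (rule bounded_directionsD(4)[OF dir])
    also have "\<dots> \<le> \<bar>C\<bar> * norm (\<Sum>i\<in>{m..<N}. a i *\<^sub>C e i)" by (intro mult_right_mono) auto
    also have "\<dots> \<le> \<bar>C\<bar> * (6 * norm ?x)" using tail by (intro mult_left_mono) auto
    finally show ?thesis .
  qed
  have A: "A (\<kappa> n) (\<Sum>i\<in>{m..<N}. a i *\<^sub>C e i) = (\<Sum>i\<in>{m..<N}. a i *\<^sub>C A (\<kappa> n) (e i))"
    by (rule additive_homogeneous_sum[OF bounded_directionsD(2)[OF dir] bounded_directionsD(3)[OF dir]])
  have T_diff: "?T (f i - e i) = ?T (f i) - ?T (e i)" for i
    by (rule linear_diff[OF bounded_linear.linear[OF bounded_linear_funpow]])
  have "?T ?x = (\<Sum>i<m. a i *\<^sub>C ?T (f i)) + (\<Sum>i\<in>{m..<N}. a i *\<^sub>C ?T (f i))"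
    unfolding power_sum by (rule split)
  also have "(\<Sum>i<m. a i *\<^sub>C ?T (f i)) = (\<Sum>i<m. a i *\<^sub>C (?T (f i) - ?h (f i))) + ?h (\<Sum>i<m. a i *\<^sub>C f i)"
    by (simp add: H_sum complex_vector.scale_right_diff_distrib sum_subtractf)
  also have "(\<Sum>i\<in>{m..<N}. a i *\<^sub>C ?T (f i)) = (\<Sum>i\<in>{m..<N}. a i *\<^sub>C ?T (f i - e i))
      + (\<Sum>i\<in>{m..<N}. a i *\<^sub>C (?T (e i) - A (\<kappa> n) (e i))) + A (\<kappa> n) (\<Sum>i\<in>{m..<N}. a i *\<^sub>C e i)"
    by (simp add: A T_diff complex_vector.scale_right_diff_distrib sum_subtractf)
  finally have "norm (?T ?x) \<le> norm (\<Sum>i<m. a i *\<^sub>C (?T (f i) - ?h (f i))) + norm (?h (\<Sum>i<m. a i *\<^sub>C f i))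
      + (norm (\<Sum>i\<in>{m..<N}. a i *\<^sub>C ?T (f i - e i))
      + norm (\<Sum>i\<in>{m..<N}. a i *\<^sub>C (?T (e i) - A (\<kappa> n) (e i))) + norm (A (\<kappa> n) (\<Sum>i\<in>{m..<N}. a i *\<^sub>C e i)))"
    by (simp only:) (intro order_trans[OF norm_triangle_ineq] add_mono order_refl)
  also have "\<dots> \<le> norm ?x + norm (H n) * (8 * norm ?x) + (norm ?x + norm ?x + \<bar>C\<bar> * (6 * norm ?x))"
    using p1 p2 p3 p4 p5 by (intro add_mono) auto
  finally show ?thesis by (simp add: algebra_simps)
qed

lemma power_tends_to:
  assumes "0 < \<delta>"
  obtains n0 where "\<And>n. n0 \<le> n \<Longrightarrow>
    norm ((blinfun_apply T ^^ \<kappa> n) (\<Sum>i<N. a i *\<^sub>C f i) - blinfun_apply (H n) (\<Sum>i<N. a i *\<^sub>C f i)) < \<delta>"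
proof -
  let ?s = "1 + (\<Sum>i<N. cmod (a i))"
  have s: "0 < ?s" by (simp add: add_pos_nonneg sum_nonneg)
  then obtain p where p: "(1/2::real) ^ p < \<delta> / ?s"
    using real_arch_pow_inv[of "\<delta> / ?s" "1/2"] assms by auto
  show thesis
  proof (rule that[of "max p N"])
    fix n assume n: "max p N \<le> n"
    have "(1/2::real) ^ (n + 4) \<le> (1/2) ^ p" using n by (intro power_decreasing) auto
    then have pn: "(1/2::real) ^ (n + 4) < \<delta> / ?s" using p by linarith
    have "norm (\<Sum>i<N. a i *\<^sub>C ((blinfun_apply T ^^ \<kappa> n) (f i) - blinfun_apply (H n) (f i)))
        \<le> (\<Sum>i<N. cmod (a i) * (1/2) ^ (n + 4))"
    proof (rule sum_norm_le)
      fix i assume "i \<in> {..<N}"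
      then have "i \<le> n" using n by auto
      then show "norm (a i *\<^sub>C ((blinfun_apply T ^^ \<kappa> n) (f i) - blinfun_apply (H n) (f i))) \<le> cmod (a i) * (1/2) ^ (n + 4)"
        unfolding norm_scaleC by (intro mult_left_mono T_H) auto
    qed
    also have "\<dots> = (\<Sum>i<N. cmod (a i)) * (1/2) ^ (n + 4)" by (simp only: sum_distrib_right)
    also have "\<dots> \<le> ?s * (1/2) ^ (n + 4)" by (intro mult_right_mono) auto
    also have "\<dots> < ?s * (\<delta> / ?s)" using pn s by (intro mult_strict_left_mono) auto
    also have "\<dots> = \<delta>" using s by simp
    finally show "norm ((blinfun_apply T ^^ \<kappa> n) (\<Sum>i<N. a i *\<^sub>C f i) - blinfun_apply (H n) (\<Sum>i<N. a i *\<^sub>C f i)) < \<delta>"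
      by (simp only: power_sum H_sum complex_vector.scale_right_diff_distrib sum_subtractf)
  qed
qed

text \<open>The closed complex-linear span of the sequence \<open>f\<close>.\<close>

definition limit_space :: "'a set" where
  "limit_space = closure {\<Sum>i<N. a i *\<^sub>C f i | a (N :: nat). True}"

lemma power_bound_closure:
  assumes "z \<in> limit_space"
  shows "norm ((blinfun_apply T ^^ \<kappa> n) z) \<le> (3 + 8 * norm (H n) + 6 * \<bar>C\<bar>) * norm z"
proof -
  let ?B = "{z. norm ((blinfun_apply T ^^ \<kappa> n) z) \<le> (3 + 8 * norm (H n) + 6 * \<bar>C\<bar>) * norm z}"
  have "closed ?B"
    by (intro closed_Collect_le continuous_intros bounded_linear.continuous_on[OF bounded_linear_funpow])
  then have "limit_space \<subseteq> ?B"
    unfolding limit_space_def by (intro closure_minimal) (auto intro: power_bound)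
  then show ?thesis using assms by blast
qed

lemma recurrence_on_limit_space:
  assumes z: "z \<in> limit_space" and inf: "\<And>m. \<exists>n\<ge>m. H n = h" and \<delta>: "0 < \<delta>"
  shows "\<exists>k>m. norm ((blinfun_apply T ^^ k) z - blinfun_apply h z) < \<delta>"
proof -
  define D where "D = 3 + 8 * norm h + 6 * \<bar>C\<bar>"
  have "0 \<le> norm h" "0 \<le> \<bar>C\<bar>" by simp_all
  then have D: "0 < D" "0 \<le> norm h" unfolding D_def by linarith+
  define \<eta> where "\<eta> = (\<delta> / 2) / (D + norm h)"
  have \<eta>: "0 < \<eta>" unfolding \<eta>_def using \<delta> D by (intro divide_pos_pos add_pos_nonneg) auto
  have "\<exists>w\<in>{\<Sum>i<N. a i *\<^sub>C f i | a (N :: nat). True}. dist w z < \<eta>"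
    using z \<eta> unfolding limit_space_def by (rule closure_approachable[THEN iffD1, rule_format])
  then obtain a N where x: "dist (\<Sum>i<N. a i *\<^sub>C f i) z < \<eta>" by (elim bexE CollectE exE conjE) simp
  let ?x = "\<Sum>i<N. a i *\<^sub>C f i"
  have x_in: "?x \<in> limit_space"
    unfolding limit_space_def by (intro subsetD[OF closure_subset] CollectI exI[of _ a] exI[of _ N] conjI refl TrueI)
  have sub: "complex_vector.subspace limit_space"
    unfolding limit_space_def by (intro subspace_closure subspace_finite_combinations)
  obtain n0 where n0: "\<And>n. n0 \<le> n \<Longrightarrow> norm ((blinfun_apply T ^^ \<kappa> n) ?x - blinfun_apply (H n) ?x) < \<delta> / 2"
    using power_tends_to[of "\<delta> / 2" a N] \<delta> half_gt_zero by blast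
  obtain n where n: "max n0 m \<le> n" "H n = h" using inf by blast
  let ?T = "blinfun_apply T ^^ \<kappa> n"
  have zx: "norm (z - ?x) \<le> \<eta>" using x by (simp add: dist_norm norm_minus_commute)
  have "z - ?x \<in> limit_space" by (rule complex_vector.subspace_diff[OF sub z x_in])
  then have "norm (?T (z - ?x)) \<le> D * norm (z - ?x)" using power_bound_closure[of "z - ?x" n] n(2) by (simp add: D_def)
  also have "\<dots> \<le> D * \<eta>" using zx D by (intro mult_left_mono) auto
  finally have 1: "norm (?T (z - ?x)) \<le> D * \<eta>" .
  have "norm (blinfun_apply h (z - ?x)) \<le> norm h * norm (z - ?x)" by (rule norm_blinfun)
  also have "\<dots> \<le> norm h * \<eta>" using zx by (intro mult_left_mono) auto
  finally have 2: "norm (blinfun_apply h (z - ?x)) \<le> norm h * \<eta>" .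
  have "?T (z - ?x) = ?T z - ?T ?x"
    by (rule linear_diff[OF bounded_linear.linear[OF bounded_linear_funpow]])
  then have "?T z - blinfun_apply h z = (?T ?x - blinfun_apply h ?x) + (?T (z - ?x) - blinfun_apply h (z - ?x))"
    by (simp add: blinfun.diff_right)
  also have "norm \<dots> \<le> norm (?T ?x - blinfun_apply h ?x) + (norm (?T (z - ?x)) + norm (blinfun_apply h (z - ?x)))"
    by (intro order_trans[OF norm_triangle_ineq] add_left_mono norm_triangle_ineq4)
  also have "\<dots> < \<delta> / 2 + (D * \<eta> + norm h * \<eta>)"
    using n0[of n] n 1 2 by (intro add_less_le_mono add_mono) auto
  also have "D * \<eta> + norm h * \<eta> = (D + norm h) * \<eta>" by (simp only: distrib_right)
  also have "\<dots> = \<delta> / 2"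
  proof -
    have "D + norm h \<noteq> 0" using D by linarith
    then show ?thesis
      unfolding \<eta>_def times_divide_eq_right[of "D + norm h" "\<delta> / 2"] by (rule nonzero_mult_div_cancel_left)
  qed
  finally have "norm (?T z - blinfun_apply h z) < \<delta>" by simp
  moreover have "m < \<kappa> n" using \<kappa>[of n] n(1) by simp
  ultimately show ?thesis by blast
qed

lemma limit_space_inf_dim: "inf_dim_closed_subspace limit_space"
  unfolding inf_dim_closed_subspace_def
proof (intro conjI)
  show "complex_vector.subspace limit_space"
    unfolding limit_space_def by (intro subspace_closure subspace_finite_combinations)
  show "closed limit_space" unfolding limit_space_def by (rule closed_closure)
  show "infinite_dimensional limit_space"
  proof (rule infinite_dimensional_if_coefficients_determined)
    show "f n \<in> limit_space" for n
    proof -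
      have "f n = (\<Sum>i<Suc n. (if i = n then 1 else 0) *\<^sub>C f i)" by simp
      then have "f n \<in> {\<Sum>i<N. a i *\<^sub>C f i | a (N :: nat). True}" by (intro CollectI exI conjI TrueI)
      then show ?thesis unfolding limit_space_def by (rule subsetD[OF closure_subset])
    qed
    show "a j = 0" if "(\<Sum>i<N. a i *\<^sub>C f i) = 0" "j < N" for a N j
      using coeff_le[OF that(2), of a] that(1) by simp
  qed
qed

end

section \<open>Spaceability\<close>

theorem theorem4p20:
  fixes T :: "'a::complex_banach \<Rightarrow>\<^sub>L 'a"
    and E :: "'a set"
    and \<theta> :: "nat \<Rightarrow> nat"
    and F :: "('a \<Rightarrow>\<^sub>L 'a) set"
  assumes "separable_space (euclidean :: 'a topology)"
    and "infinite_dimensional (UNIV :: 'a set)"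
    and "T \<in> complex_operators"
    and "Omega_limits T \<noteq> {}"
    and "pos_strict_seq \<theta>"
    and "inf_dim_closed_subspace E"
    and "bdd_above (range (\<lambda>n. onorm_on E (blinfun_apply T ^^ \<theta> n)))"
    and "F \<subseteq> Omega_limits T"
    and "SOT_separable F"
  shows "spaceable (\<Inter>h\<in>F. R_set T h)"
proof (cases "F = {}")
  case True
  then show ?thesis using assms(6) unfolding spaceable_def by auto
next
  case False
  obtain F0 where F0: "countable F0" "F0 \<subseteq> F" "F \<subseteq> strong_operator_topology closure_of F0"
  proof -
    obtain G where "countable G" "G \<subseteq> F" "subtopology strong_operator_topology F closure_of G = F"
      using assms(9) unfolding SOT_separable_def separable_space_def
      by (auto simp: strong_operator_topology_topspace)
    then show thesis
      using closure_of_subtopology_subset[of strong_operator_topology F G] by (intro that[of G]) auto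
  qed
  have "F0 \<noteq> {}" using F0(3) False by auto
  \<comment> \<open>an enumeration that hits every element of \<open>F0\<close> infinitely often\<close>
  define H where "H n = from_nat_into F0 (fst (prod_decode n))" for n
  have H_in: "H n \<in> F0" for n unfolding H_def by (rule from_nat_into[OF \<open>F0 \<noteq> {}\<close>])
  have H_inf: "\<exists>n\<ge>m. H n = h" if "h \<in> F0" for h m
  proof -
    obtain i where "from_nat_into F0 i = h" using from_nat_into_surj[OF F0(1) \<open>h \<in> F0\<close>] by blast
    then show ?thesis by (intro exI[of _ "prod_encode (i, m)"]) (simp add: H_def le_prod_encode_2)
  qed
  have H_Omega: "H n \<in> Omega_limits T" for n using H_in[of n] F0(2) assms(8) by blast
  then have H_complex: "H n \<in> complex_operators" for n unfolding Omega_limits_def by blast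
  obtain M where M0: "\<And>n. onorm_on E (blinfun_apply T ^^ \<theta> n) \<le> M"
    using assms(7) unfolding bdd_above_def by auto
  have M: "norm ((blinfun_apply T ^^ \<theta> n) x) \<le> M * norm x" if "x \<in> E" for n x
    by (rule onorm_on_bound[OF that M0])
  have E: "complex_vector.subspace E" "infinite_dimensional E" and \<theta>: "strict_mono \<theta>"
    using assms(5,6) unfolding inf_dim_closed_subspace_def pos_strict_seq_def by auto
  obtain C A V where dir: "bounded_directions T C A V"
  proof (rule exists_bounded_directions[OF assms(3) E \<theta>])
    show "norm ((blinfun_apply T ^^ \<theta> n) x) \<le> M * norm x" if "x \<in> E" for n x by (rule M[OF that])
  qed
  obtain d :: "nat \<Rightarrow> 'a" where d: "closure (range d) = UNIV"
    "\<forall>n N m. \<forall>\<epsilon>>0. \<exists>k>m. \<forall>i<N. norm ((blinfun_apply T ^^ k) (d i) - blinfun_apply (H n) (d i)) < \<epsilon>"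
    by (rule common_dense_sequence[OF assms(1) H_Omega])
  obtain e f \<kappa> where "interlaced T H C A V e f \<kappa>"
    by (rule interlaced_sequences[OF assms(3) H_complex dir d])
  then interpret interlaced T H C A V e f \<kappa> .
  have "limit_space \<subseteq> (\<Inter>h\<in>F. R_set T h)"
  proof (intro subsetI INT_I)
    fix z h assume z: "z \<in> limit_space" and h: "h \<in> F"
    show "z \<in> R_set T h"
      by (rule R_sets_of_SOT_dense_subset[OF F0(3) h]) (intro recurrence_on_limit_space z H_inf)
  qed
  then show ?thesis using limit_space_inf_dim unfolding spaceable_def by blast
qed

end
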